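(* Let $(X,\sigma)$ be a topologically mixing (one-sided) subshift of finite type. Then there is an uncountable collection $\mathcal{N}$ of Borel measurable subsets of $X$ satisfying: (1) there is a continuous function $\varphi\colon X\to\mathbb{R}$ such that every $N\in\mathcal{N}$ is contained in $\hat{X}(\varphi)$; (2) every $N\in\mathcal{N}$ is dense in $X$ and satisfies $\sigma(N)\subset N$; (3) for every distinct $N,N'\in\mathcal{N}$ we have $N\cap N'=\emptyset$; (4) for every $N\in\mathcal{N}$ we have $\dim_H N=\dim_H X$ and $h(\sigma|N)=h_{top}(\sigma)$.
   Context: Subshift of finite type: given a $d\times d$ matrix $A$ with entries in $\{0,1\}$, $X=\{(x_i)_{i\ge 0}: x_i\in\{0,1,\ldots,d-1\},\ A(x_i,x_{i+1})=1\text{ for every }i\ge 0\}$, with the shift $\sigma((x_i)_{i\ge0})=(x_{i+1})_{i\ge 0}$. It is topologically mixing if $A$ is aperiodic, i.e. there is $k\in\mathbb{N}$ such that all entries of $A^k$ are positive; equivalently, for any two nonempty open sets $U,V\subset X$ there is $n_0\in\mathbb{N}$ such that $\sigma^n(U)\cap V\ne\emptyset$ for every $n\ge n_0$. The metric on $X$ is $\mathrm{dist}(x,y)=e^{-\min\{i\ge 0:\,x_i\ne y_i\}}$ for $x\neq y$, and $\mathrm{dist}(x,x)=0$; $\dim_H$ denotes Hausdorff dimension with respect to this metric. Irregular set: for continuous $\varphi\colon X\to\mathbb{R}$, $\hat{X}(\varphi)$ is the set of $x\in X$ for which $\lim_{n\to\infty}\frac1n\sum_{j=0}^{n-1}\varphi(\sigma^j(x))$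 does not exist. Topological entropy of a (not necessarily compact or invariant) subset: let $f\colon X\to X$ be a continuous map of a compact metric space and $Z\subset X$. For an open cover $\mathcal{U}$ of $X$, a string $\mathbf{U}=U_{0}\cdots U_{m-1}$ of elements of $\mathcal{U}$ has length $m(\mathbf{U})=m$, and $X(\mathbf{U})=\{x\in X: f^j(x)\in U_j,\ 0\le j\le m-1\}$. For $\alpha\in\mathbb{R}$ put $m_{\mathcal{U}}(Z,\alpha)=\lim_{n\to\infty}\inf\{\sum_{\mathbf{U}\in\mathcal{G}}e^{-\alpha m(\mathbf{U})}\}$, the infimum over finite or countable collections $\mathcal{G}$ of strings with $m(\mathbf{U})\ge n$ for all $\mathbf{U}\in\mathcal{G}$ and $Z\subset\bigcup_{\mathbf{U}\in\mathcal{G}}X(\mathbf{U})$. Let $h_{\mathcal{U}}(f|Z)=\inf\{\alpha: m_{\mathcal{U}}(Z,\alpha)=0\}$ and $h(f|Z)=\lim_{\operatorname{diam}(\mathcal{U})\to0}h_{\mathcal{U}}(f|Z)$ (this limit exists), where $\operatorname{diam}(\mathcal{U})=\sup\{\operatorname{diam}(U):U\in\mathcal{U}\}$. $h_{top}(f)$ denotes the usual topological entropy, which equals $h(f|X)$.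
   Formalization: The alphabet size d is assumed to be at least 2: for d = 1 and A = [1] the subshift is a single point, which is mixing, but every irregular set is empty and no uncountable collection of subsets exists, so the claim as stated fails there. *)

theory Defs
  imports
    "HOL-Analysis.Analysis"
    "Jordan_Normal_Form.Matrix"
begin

context Metric_space
begin

text \<open>Valued in \<^typ>\<open>ennreal\<close>, so that the empty set has diameter 0 and unbounded sets
  have diameter \<open>\<infinity>\<close>.\<close>

definition ediam :: "'a set \<Rightarrow> ennreal" where
  "ediam U = (SUP x\<in>U. SUP y\<in>U. ennreal (d x y))"

definition borel_subsets :: "'a set set" where
  "borel_subsets = sigma_sets M {U. openin mtopology U}"

definition hausdorff_premeasure :: "real \<Rightarrow> real \<Rightarrow> 'a set \<Rightarrow> ennreal" where
  "hausdorff_premeasure s \<delta> Z =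
     Inf {(\<Sum>i. ennreal (enn2real (ediam (C i)) powr s)) | C :: nat \<Rightarrow> 'a set.
            (\<forall>i. C i \<subseteq> M \<and> ediam (C i) \<le> ennreal \<delta>) \<and> Z \<subseteq> (\<Union>i. C i)}"

definition hausdorff_measure :: "real \<Rightarrow> 'a set \<Rightarrow> ennreal" where
  "hausdorff_measure s Z = (SUP \<delta>\<in>{0<..}. hausdorff_premeasure s \<delta> Z)"

text \<open>Only exponents \<open>s > 0\<close> are used: this does not change the infimum, and it avoids
  the value of \<open>0 powr 0\<close>, which is 0 in HOL.\<close>

definition hausdorff_dim :: "'a set \<Rightarrow> ereal" where
  "hausdorff_dim Z = Inf (ereal ` {s. 0 < s \<and> hausdorff_measure s Z = 0})"

definition open_covers :: "'a set set set" where
  "open_covers = {\<U>. (\<forall>U\<in>\<U>. openin mtopology U) \<and> \<Union>\<U> = M}"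

definition cover_diam :: "'a set set \<Rightarrow> ennreal" where
  "cover_diam \<U> = (SUP U\<in>\<U>. ediam U)"

definition string_set :: "('a \<Rightarrow> 'a) \<Rightarrow> 'a set list \<Rightarrow> 'a set" where
  "string_set f u = {x \<in> M. \<forall>j<length u. (f ^^ j) x \<in> u ! j}"

definition cover_premeasure ::
  "('a \<Rightarrow> 'a) \<Rightarrow> 'a set set \<Rightarrow> 'a set \<Rightarrow> real \<Rightarrow> nat \<Rightarrow> ennreal" where
  "cover_premeasure f \<U> Z \<alpha> n =
     Inf {(\<Sum>\<^sub>\<infinity>u\<in>G. ennreal (exp (- \<alpha> * real (length u)))) | G.
            countable G \<and> G \<subseteq> lists \<U> \<and> (\<forall>u\<in>G. n \<le> length u) \<and> Z \<subseteq> (\<Union>u\<in>G. string_set f u)}"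

definition cover_measure :: "('a \<Rightarrow> 'a) \<Rightarrow> 'a set set \<Rightarrow> 'a set \<Rightarrow> real \<Rightarrow> ennreal" where
  "cover_measure f \<U> Z \<alpha> = lim (\<lambda>n. cover_premeasure f \<U> Z \<alpha> n)"

definition cover_entropy :: "('a \<Rightarrow> 'a) \<Rightarrow> 'a set set \<Rightarrow> 'a set \<Rightarrow> ereal" where
  "cover_entropy f \<U> Z = Inf (ereal ` {\<alpha>. cover_measure f \<U> Z \<alpha> = 0})"

text \<open>Topological entropy of \<open>f\<close> on an arbitrary subset \<open>Z\<close>: the limit of
  \<^const>\<open>cover_entropy\<close> over the open covers of the whole space, as their diameter tends to 0.\<close>

definition entropy_on :: "('a \<Rightarrow> 'a) \<Rightarrow> 'a set \<Rightarrow> ereal" where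
  "entropy_on f Z =
     Lim (inf (filtercomap cover_diam (nhds 0)) (principal open_covers))
       (\<lambda>\<U>. cover_entropy f \<U> Z)"

definition separated :: "('a \<Rightarrow> 'a) \<Rightarrow> nat \<Rightarrow> real \<Rightarrow> 'a set \<Rightarrow> bool" where
  "separated f n \<epsilon> E \<longleftrightarrow> finite E \<and> E \<subseteq> M \<and>
     (\<forall>x\<in>E. \<forall>y\<in>E. x \<noteq> y \<longrightarrow> (\<exists>j<n. d ((f ^^ j) x) ((f ^^ j) y) > \<epsilon>))"

text \<open>The usual topological entropy, in Bowen's form with \<open>(n, \<epsilon>)\<close>-separated sets. The supremum
  of \<open>ln (card E)\<close> is the logarithm of the maximal cardinality of such a set.\<close>

definition topological_entropy :: "('a \<Rightarrow> 'a) \<Rightarrow> ereal" where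
  "topological_entropy f =
     Lim (at_right 0)
       (\<lambda>\<epsilon>. limsup (\<lambda>n. SUP E\<in>{E. separated f n \<epsilon> E}. ereal (ln (real (card E)) / real n)))"

end


definition aperiodic :: "nat mat \<Rightarrow> bool" where
  "aperiodic A \<longleftrightarrow> (\<exists>k\<ge>1. \<forall>i<dim_row A. \<forall>j<dim_col A. (A ^\<^sub>m k) $$ (i, j) > 0)"

definition sft :: "nat mat \<Rightarrow> (nat \<Rightarrow> nat) set" where
  "sft A = {x. \<forall>i. x i < dim_row A \<and> A $$ (x i, x (Suc i)) = 1}"

definition shift :: "(nat \<Rightarrow> nat) \<Rightarrow> nat \<Rightarrow> nat" where
  "shift x = (\<lambda>i. x (Suc i))"

definition seq_dist :: "(nat \<Rightarrow> nat) \<Rightarrow> (nat \<Rightarrow> nat) \<Rightarrow> real" where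
  "seq_dist x y = (if x = y then 0 else exp (- real (LEAST i. x i \<noteq> y i)))"

definition irregular_set :: "(nat \<Rightarrow> nat) set \<Rightarrow> ((nat \<Rightarrow> nat) \<Rightarrow> real) \<Rightarrow> (nat \<Rightarrow> nat) set" where
  "irregular_set X \<phi> =
     {x \<in> X. \<not> convergent (\<lambda>n. (\<Sum>j<n. \<phi> ((shift ^^ j) x)) / real n)}"

lemma seq_dist_ultrametric: "seq_dist x z \<le> max (seq_dist x y) (seq_dist y z)"
proof (cases "x = z \<or> x = y \<or> y = z")
  case True
  then show ?thesis by (auto simp: seq_dist_def le_max_iff_disj)
next
  case False
  define m where "m = (LEAST i. x i \<noteq> z i)"
  have "\<exists>i. x i \<noteq> z i" using False by auto
  then have "x m \<noteq> z m" unfolding m_def by (rule LeastI_ex)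
  then have "x m \<noteq> y m \<or> y m \<noteq> z m" by auto
  then have "(LEAST i. x i \<noteq> y i) \<le> m \<or> (LEAST i. y i \<noteq> z i) \<le> m"
    by (auto intro: Least_le)
  then show ?thesis using False by (auto simp: seq_dist_def m_def le_max_iff_disj)
qed

lemma Metric_space_seq_dist: "Metric_space X seq_dist"
proof
  show "0 \<le> seq_dist x y" for x y by (simp add: seq_dist_def)
  show "seq_dist x y = seq_dist y x" for x y by (simp add: seq_dist_def eq_commute)
  show "(seq_dist x y = 0) = (x = y)" for x y by (simp add: seq_dist_def)
  show "seq_dist x z \<le> seq_dist x y + seq_dist y z" for x y z
  proof -
    have "0 \<le> seq_dist x y" "0 \<le> seq_dist y z" by (simp_all add: seq_dist_def)
    then show ?thesis using seq_dist_ultrametric[of x z y] by linarith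
  qed
qed

lemma shift_in_sft: "x \<in> sft A \<Longrightarrow> shift x \<in> sft A"
  by (simp add: sft_def shift_def)

end

theory Submission
  imports Defs "HOL-Probability.Infinite_Product_Measure"
begin

section \<open>Disjoint irregular sets of full dimension and entropy\<close>

text \<open>Let \<open>q\<close> be a common length of two distinct loops \<open>u\<close>, \<open>v\<close> at the state \<open>0\<close>, let
  \<open>D x = {i. x (i + q) \<noteq> x i}\<close>, and let \<open>\<phi> x\<close> be \<open>1\<close> or \<open>0\<close> according to whether \<open>0 \<in> D x\<close>. The
  Birkhoff averages of \<open>\<phi>\<close> are the relative densities of \<open>D x\<close>, and they diverge if \<open>D x\<close> has
  positive upper density and infinitely many gaps \<open>[n, (1 + r) n]\<close> with \<open>r > 0\<close>. The supremum \<open>\<rho>\<close>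
  of such \<open>r\<close> is invariant under the shift and does not depend on any finite prefix of \<open>x\<close>. For
  \<open>1 < t < 2\<close> let \<open>N t\<close> consist of the points with positive upper density and
  \<open>\<rho> \<in> {t / 2, t / 4, t / 8, \<dots>}\<close>; these sets are Borel, invariant, dense and pairwise disjoint.

  For every small \<open>\<rho>\<close> of this form, \<open>N t\<close> contains a Moran set of concatenations of loops of a fixed
  length: copies of \<open>u\<close> in the windows \<open>4 ^ j < i \<le> (1 + \<rho>) 4 ^ j\<close> of the block index \<open>i\<close>, and
  elsewhere \<open>u v\<close> followed by a freely chosen word of \<open>X\<close>. The windows have density at most \<open>2 \<rho>\<close>,
  so the uniform measure on the choices gives every lower bound below the exponential growth rate of
  the number of words for both the dimension and the entropy of \<open>N t\<close>. The growth rate itself is an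
  upper bound for all subsets of \<open>X\<close>.\<close>

subsection \<open>Sequence spaces and cylinders\<close>

text \<open>Taken in the space of all sequences, so that the centre need not belong to
  \<open>X\<close> and one notion serves every subset.\<close>

definition cylinder :: "nat \<Rightarrow> (nat \<Rightarrow> nat) \<Rightarrow> (nat \<Rightarrow> nat) set" where
  "cylinder n x = {y. \<forall>i<n. y i = x i}"

lemma seq_dist_le_exp_iff: "seq_dist x y \<le> exp (- real n) \<longleftrightarrow> y \<in> cylinder n x"
proof (cases "x = y")
  case True
  then show ?thesis by (simp add: seq_dist_def cylinder_def)
next
  case False
  define m where "m = (LEAST i. x i \<noteq> y i)"
  have ex: "\<exists>i. x i \<noteq> y i" using False by auto
  have m: "x m \<noteq> y m" unfolding m_def using ex by (rule LeastI_ex)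
  have less: "x i = y i" if "i < m" for i
    using not_less_Least that unfolding m_def by blast
  have "seq_dist x y \<le> exp (- real n) \<longleftrightarrow> n \<le> m"
    using False by (simp add: seq_dist_def m_def)
  also have "\<dots> \<longleftrightarrow> y \<in> cylinder n x"
  proof
    assume "n \<le> m"
    then show "y \<in> cylinder n x" using less by (simp add: cylinder_def)
  next
    assume "y \<in> cylinder n x"
    then show "n \<le> m" using m by (force simp: cylinder_def not_le[symmetric])
  qed
  finally show ?thesis .
qed

text \<open>Distances only take the values 0 and \<open>exp (- m)\<close>, so a strict bound fixes
  one coordinate more than the weak one.\<close>

lemma seq_dist_less_exp_iff: "seq_dist x y < exp (- real n) \<longleftrightarrow> y \<in> cylinder (Suc n) x"
proof (cases "x = y")
  case True
  then show ?thesis by (simp add: seq_dist_def cylinder_def)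
next
  case False
  then have "seq_dist x y < exp (- real n) \<longleftrightarrow> seq_dist x y \<le> exp (- real (Suc n))"
    by (auto simp: seq_dist_def)
  then show ?thesis by (simp only: seq_dist_le_exp_iff)
qed

lemma cylinder_antimono: "m \<le> n \<Longrightarrow> cylinder n x \<subseteq> cylinder m x"
  by (auto simp: cylinder_def)

lemma exists_exp_less: "\<exists>n. exp (- real n) < (r::real)" if "0 < r"
proof -
  obtain n :: nat where "- ln r < real n" using reals_Archimedean2 by blast
  then have "exp (- real n) < exp (ln r)" by simp
  then show ?thesis using that by auto
qed

lemma funpow_shift: "(shift ^^ n) x = (\<lambda>i. x (n + i))"
  by (induction n arbitrary: x) (auto simp: shift_def funpow_swap1)

locale sequence_space = fixes X :: "(nat \<Rightarrow> nat) set"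
begin

sublocale Metric_space X seq_dist
  by (rule Metric_space_seq_dist)

lemma openin_cylinderI:
  assumes "U \<subseteq> X" and "\<And>x. x \<in> U \<Longrightarrow> \<exists>n. X \<inter> cylinder n x \<subseteq> U"
  shows "openin mtopology U"
  unfolding openin_mtopology_mcball
proof (intro conjI allI impI)
  fix x assume "x \<in> U"
  then obtain n where "X \<inter> cylinder n x \<subseteq> U" using assms by blast
  moreover have "mcball x (exp (- real n)) \<subseteq> X \<inter> cylinder n x"
    by (auto simp: seq_dist_le_exp_iff)
  ultimately show "\<exists>r>0. mcball x r \<subseteq> U" using exp_gt_zero by blast
qed (fact assms)

lemma openin_cylinderD:
  assumes "openin mtopology U" "x \<in> U"
  obtains n where "X \<inter> cylinder n x \<subseteq> U"
proof -
  obtain r where r: "r > 0" "mcball x r \<subseteq> U" using assms unfolding openin_mtopology_mcball by blast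
  obtain n where n: "exp (- real n) < r" using exists_exp_less r by blast
  have "x \<in> X" using assms openin_subset by fastforce
  then have "X \<inter> cylinder n x \<subseteq> mcball x r"
    using n by (auto simp: seq_dist_le_exp_iff[symmetric])
  then show thesis using that r by blast
qed

lemma closure_of_eq_spaceI:
  assumes "\<And>x n. x \<in> X \<Longrightarrow> \<exists>y\<in>N. y \<in> X \<inter> cylinder n x"
  shows "mtopology closure_of N = X"
proof -
  have "\<exists>y\<in>N. y \<in> mball x r" if x: "x \<in> X" and "0 < r" for x r
  proof -
    obtain n where n: "exp (- real n) < r" using exists_exp_less \<open>0 < r\<close> by blast
    obtain y where "y \<in> N" "y \<in> X" "y \<in> cylinder n x" using assms x by blast
    then show ?thesis
      using n x by (intro bexI[of _ y]) (auto simp: seq_dist_le_exp_iff[symmetric])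
  qed
  then show ?thesis unfolding metric_closure_of by blast
qed

lemma borel_finitely_determined:
  assumes "\<And>x y. x \<in> X \<Longrightarrow> y \<in> X \<Longrightarrow> y \<in> cylinder n x \<Longrightarrow> Q x \<Longrightarrow> Q y"
  shows "{x\<in>X. Q x} \<in> borel_subsets"
proof -
  have "openin mtopology {x\<in>X. Q x}"
    using assms by (intro openin_cylinderI) auto
  then show ?thesis unfolding borel_subsets_def by (auto intro: sigma_sets.Basic)
qed

lemma sigma_algebra_borel: "sigma_algebra X borel_subsets"
  unfolding borel_subsets_def using openin_subset
  by (intro sigma_algebra_sigma_sets) fastforce

lemma continuous_map_finitely_determined:
  fixes \<phi> :: "(nat \<Rightarrow> nat) \<Rightarrow> real"
  assumes "\<And>x y. x \<in> X \<Longrightarrow> y \<in> X \<Longrightarrow> y \<in> cylinder n x \<Longrightarrow> \<phi> y = \<phi> x"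
  shows "continuous_map mtopology euclideanreal \<phi>"
  unfolding continuous_map_def
proof (intro conjI allI impI)
  fix U :: "real set"
  have "openin mtopology {x \<in> X. \<phi> x \<in> U}"
    by (rule openin_cylinderI) (use assms in \<open>auto intro!: exI[of _ n]\<close>)
  then show "openin mtopology {x \<in> topspace mtopology. \<phi> x \<in> U}" by simp
qed auto

lemma ediam_le_exp:
  assumes "\<And>x y. x \<in> C \<Longrightarrow> y \<in> C \<Longrightarrow> y \<in> cylinder n x"
  shows "ediam C \<le> ennreal (exp (- real n))"
  unfolding ediam_def
  by (intro SUP_least ennreal_leI) (use assms in \<open>simp add: seq_dist_le_exp_iff\<close>)

lemma seq_dist_le_ediam: "x \<in> C \<Longrightarrow> y \<in> C \<Longrightarrow> ennreal (seq_dist x y) \<le> ediam C"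
  unfolding ediam_def by (meson SUP_upper2 order_refl)

text \<open>All distances are at most 1. Finiteness matters because \<open>enn2real\<close> maps
  infinity to 0.\<close>

lemma ediam_finite: "ediam C < \<infinity>"
proof -
  have "ediam C \<le> ennreal (exp (- real 0))"
    by (rule ediam_le_exp) (simp add: cylinder_def)
  then show ?thesis by (simp add: le_less_trans)
qed

end

subsection \<open>A mass distribution principle\<close>

text \<open>Both the Hausdorff dimension and the entropy of a set carrying a measure \<open>\<mu>\<close> with
  \<open>\<mu> (cylinder n x) \<le> K * exp (- s * n)\<close> are at least \<open>s\<close>; the two bounds only use this
  consequence.\<close>

definition cylinder_mass :: "(nat \<Rightarrow> nat) set \<Rightarrow> real \<Rightarrow> bool" where
  "cylinder_mass Z s \<longleftrightarrow> (\<exists>c>0. \<forall>J w n. Z \<subseteq> (\<Union>i\<in>J. cylinder (n i) (w i)) \<longrightarrow>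
     ennreal c \<le> (\<Sum>\<^sub>\<infinity>i\<in>J. ennreal (exp (- s * real (n (i::nat))))))"

lemma infsum_ennreal_mono:
  fixes f g :: "'a \<Rightarrow> ennreal"
  assumes "\<And>x. x \<in> A \<Longrightarrow> f x \<le> g x"
  shows "infsum f A \<le> infsum g A"
  using assms by (intro infsum_mono nonneg_summable_on_complete) auto

lemma suminf_eq_infsum_ennreal: "(\<Sum>i. f i) = (\<Sum>\<^sub>\<infinity>i\<in>UNIV. f i)" for f :: "nat \<Rightarrow> ennreal"
proof -
  have "(f has_sum infsum f UNIV) UNIV"
    by (intro has_sum_infsum nonneg_summable_on_complete) auto
  then show ?thesis using has_sum_imp_sums sums_unique by fastforce
qed

lemma emeasure_UN_le_infsum:
  fixes J :: "nat set"
  assumes "\<And>i. i \<in> J \<Longrightarrow> B i \<in> sets M"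
  shows "emeasure M (\<Union>i\<in>J. B i) \<le> (\<Sum>\<^sub>\<infinity>i\<in>J. emeasure M (B i))"
proof -
  define C where "C i = (if i \<in> J then B i else {})" for i
  have "(\<Union>i\<in>J. B i) = (\<Union>i. C i)" by (auto simp: C_def split: if_splits)
  then have "emeasure M (\<Union>i\<in>J. B i) \<le> (\<Sum>i. emeasure M (C i))"
    using emeasure_subadditive_countably[of C M] assms by (auto simp: C_def image_subset_iff)
  also have "\<dots> = (\<Sum>\<^sub>\<infinity>i\<in>J. emeasure M (B i))"
    unfolding suminf_eq_infsum_ennreal by (rule infsum_cong_neutral) (auto simp: C_def)
  finally show ?thesis .
qed

text \<open>Allows an exponent to be exchanged for any smaller one: lengths are nonnegative, so the
  sums over covers only grow.\<close>

lemma cylinder_mass_mono: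
  assumes "cylinder_mass Z s" "s' \<le> s" "Z \<subseteq> Z'"
  shows "cylinder_mass Z' s'"
proof -
  obtain c where c: "c > 0" "\<And>(J::nat set) w n. Z \<subseteq> (\<Union>i\<in>J. cylinder (n i) (w i)) \<Longrightarrow>
     ennreal c \<le> (\<Sum>\<^sub>\<infinity>i\<in>J. ennreal (exp (- s * real (n i))))"
    using assms unfolding cylinder_mass_def by blast
  show ?thesis unfolding cylinder_mass_def
  proof (intro exI[of _ c] conjI allI impI)
    fix J :: "nat set" and w n assume "Z' \<subseteq> (\<Union>i\<in>J. cylinder (n i) (w i))"
    then have "ennreal c \<le> (\<Sum>\<^sub>\<infinity>i\<in>J. ennreal (exp (- s * real (n i))))"
      by (intro c(2)[where w = w]) (use assms(3) in blast)
    also have "\<dots> \<le> (\<Sum>\<^sub>\<infinity>i\<in>J. ennreal (exp (- s' * real (n i))))"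
      using assms by (intro infsum_ennreal_mono ennreal_leI) (simp add: mult_right_mono)
    finally show "ennreal c \<le> (\<Sum>\<^sub>\<infinity>i\<in>J. ennreal (exp (- s' * real (n i))))" .
  qed (fact c)
qed

context sequence_space
begin

text \<open>The first coordinate at which two points of \<open>C\<close> differ is the length of the
  smallest cylinder around \<open>C\<close>, and it is witnessed by a pair at distance at least
  \<open>exp (- n)\<close>. If \<open>C\<close> has at most one point, its diameter is 0 and
  \<epsilon> pays for a sufficiently long cylinder.\<close>

lemma cover_by_cylinder:
  assumes "s > 0" "\<epsilon> > 0"
  shows "\<exists>n w. C \<subseteq> cylinder n w \<and> exp (- s * real n) \<le> enn2real (ediam C) powr s + \<epsilon>"
proof (cases "\<exists>i. \<exists>x\<in>C. \<exists>y\<in>C. x i \<noteq> y i")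
  case True
  define n where "n = (LEAST i. \<exists>x\<in>C. \<exists>y\<in>C. x i \<noteq> y i)"
  have "\<exists>x\<in>C. \<exists>y\<in>C. x n \<noteq> y n" unfolding n_def using True by (rule LeastI_ex)
  then obtain x y where xy: "x \<in> C" "y \<in> C" "x n \<noteq> y n" by blast
  have eq: "x' i = y' i" if "i < n" "x' \<in> C" "y' \<in> C" for i x' y'
    using not_less_Least[of i "\<lambda>i. \<exists>x\<in>C. \<exists>y\<in>C. x i \<noteq> y i"] that unfolding n_def by blast
  have "\<not> seq_dist x y < exp (- real n)"
    using xy unfolding seq_dist_less_exp_iff by (force simp: cylinder_def)
  then have "ennreal (exp (- real n)) \<le> ennreal (seq_dist x y)" by (intro ennreal_leI) simp
  also have "\<dots> \<le> ediam C" by (rule seq_dist_le_ediam[OF xy(1,2)])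
  finally have "exp (- real n) \<le> enn2real (ediam C)"
    using enn2real_mono ediam_finite[of C] by fastforce
  then have "exp (- real n) powr s \<le> enn2real (ediam C) powr s"
    using assms by (intro powr_mono2) auto
  moreover have "exp (- real n) powr s = exp (- s * real n)"
    by (simp add: powr_def)
  ultimately show ?thesis
    using xy eq assms by (intro exI[of _ n] exI[of _ x]) (auto simp: cylinder_def)
next
  case False
  obtain n where n: "exp (- real n) < \<epsilon> powr (1/s)" using exists_exp_less[of "\<epsilon> powr (1/s)"] assms by auto
  have "exp (- s * real n) = exp (- real n) powr s" by (simp add: powr_def)
  also have "\<dots> \<le> (\<epsilon> powr (1/s)) powr s" using n assms by (intro powr_mono2) auto
  also have "\<dots> = \<epsilon>" using assms by (simp add: powr_powr)
  finally have "exp (- s * real n) \<le> enn2real (ediam C) powr s + \<epsilon>" by (simp add: add_increasing)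
  moreover have "\<exists>w. C \<subseteq> cylinder n w"
    using False by (cases "C = {}") (auto simp: cylinder_def subset_iff, metis)
  ultimately show ?thesis by blast
qed

section \<open>Lower bounds for the dimension from cylinder mass\<close>

lemma hausdorff_measure_pos:
  assumes "cylinder_mass Z s" "s > 0"
  shows "hausdorff_measure s Z \<noteq> 0"
proof
  assume zero: "hausdorff_measure s Z = 0"
  obtain c where c: "c > 0" "\<And>(J::nat set) w n. Z \<subseteq> (\<Union>i\<in>J. cylinder (n i) (w i)) \<Longrightarrow>
     ennreal c \<le> (\<Sum>\<^sub>\<infinity>i\<in>J. ennreal (exp (- s * real (n i))))"
    using assms unfolding cylinder_mass_def by blast
  \<comment> \<open>The measure is a supremum over scales, so if it vanishes then so does the
    premeasure at the single scale 1.\<close>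
  have "hausdorff_premeasure s 1 Z \<le> hausdorff_measure s Z"
    unfolding hausdorff_measure_def by (rule SUP_upper) auto
  then have "hausdorff_premeasure s 1 Z < ennreal (c/2)" using zero c
    by (metis ennreal_less_zero_iff half_gt_zero le_zero_eq)
  then obtain C :: "nat \<Rightarrow> (nat \<Rightarrow> nat) set" where
    C: "Z \<subseteq> (\<Union>i. C i)" "(\<Sum>i. ennreal (enn2real (ediam (C i)) powr s)) < ennreal (c/2)"
    unfolding hausdorff_premeasure_def Inf_less_iff by blast
  \<comment> \<open>These errors sum to \<open>c / 2\<close>; together with a cover of cost below
    \<open>c / 2\<close> they contradict the lower bound \<open>c\<close>.\<close>
  define \<epsilon> where "\<epsilon> i = (c/2) * (1/2) ^ Suc i" for i
  have \<epsilon>: "\<epsilon> i > 0" for i using c by (simp add: \<epsilon>_def)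
  obtain n w where nw: "\<And>i. C i \<subseteq> cylinder (n i) (w i)"
     "\<And>i. exp (- s * real (n i)) \<le> enn2real (ediam (C i)) powr s + \<epsilon> i"
  proof -
    have "\<forall>i. \<exists>n w. C i \<subseteq> cylinder n w \<and> exp (- s * real n) \<le> enn2real (ediam (C i)) powr s + \<epsilon> i"
      using cover_by_cylinder[OF assms(2) \<epsilon>] by blast
    then show thesis unfolding choice_iff using that by blast
  qed
  have "(\<lambda>i. (c/2) * (1/2) ^ Suc i) sums ((c/2) * 1)"
    by (intro sums_mult power_half_series)
  then have sums: "\<epsilon> sums (c/2)" by (simp only: \<epsilon>_def[abs_def] mult_1_right)
  have "ennreal c \<le> (\<Sum>i. ennreal (exp (- s * real (n i))))"
    unfolding suminf_eq_infsum_ennreal by (intro c(2)[of n w UNIV]) (use C(1) nw(1) in blast)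
  also have "\<dots> \<le> (\<Sum>i. ennreal (enn2real (ediam (C i)) powr s) + ennreal (\<epsilon> i))"
    using nw(2) \<epsilon> by (intro suminf_le)
      (auto simp: ennreal_plus[symmetric] less_imp_le simp del: ennreal_plus intro!: ennreal_leI)
  also have "\<dots> = (\<Sum>i. ennreal (enn2real (ediam (C i)) powr s)) + (\<Sum>i. ennreal (\<epsilon> i))"
    by (intro suminf_add[symmetric]) auto
  also have "(\<Sum>i. ennreal (\<epsilon> i)) = ennreal (c/2)"
    using suminf_ennreal2[OF less_imp_le[OF \<epsilon>] sums_summable[OF sums]] sums_unique[OF sums] by simp
  also have "(\<Sum>i. ennreal (enn2real (ediam (C i)) powr s)) + ennreal (c/2) < ennreal (c/2) + ennreal (c/2)"
    using C(2) by (subst (1 2) add.commute) (simp only: ennreal_add_left_cancel_less, simp)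
  also have "\<dots> = ennreal c" using c by (simp add: ennreal_plus[symmetric] del: ennreal_plus)
  finally show False by simp
qed

lemma hausdorff_dim_ge:
  assumes "cylinder_mass Z s"
  shows "ereal s \<le> hausdorff_dim Z"
  unfolding hausdorff_dim_def
proof (rule Inf_greatest, clarify)
  fix t assume t: "0 < t" "hausdorff_measure t Z = 0"
  have "\<not> t \<le> s"
    using hausdorff_measure_pos[OF cylinder_mass_mono[OF assms _ order_refl]] t by blast
  then show "ereal s \<le> ereal t" by simp
qed

section \<open>Lower bounds for the entropy of open covers\<close>

lemma cover_premeasure_mono: "m \<le> n \<Longrightarrow> cover_premeasure f \<U> Z \<alpha> m \<le> cover_premeasure f \<U> Z \<alpha> n"
  unfolding cover_premeasure_def by (rule Inf_superset_mono) force

text \<open>Raising the minimal length shrinks the family of admissible covers, so the sequence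
  increases and the limit in the definition exists as a supremum.\<close>

lemma cover_measure_eq_SUP: "cover_measure f \<U> Z \<alpha> = (SUP n. cover_premeasure f \<U> Z \<alpha> n)"
  unfolding cover_measure_def
  by (intro limI LIMSEQ_SUP) (simp add: incseq_def cover_premeasure_mono)

text \<open>All points of a set of diameter below 1 share coordinate 0. A string of \<open>m\<close>
  such sets therefore fixes the first \<open>m\<close> coordinates, and a cover by strings yields a
  cover by cylinders of the same lengths.\<close>

lemma cover_measure_pos:
  assumes mass: "cylinder_mass Z s" and diam: "cover_diam \<U> < 1"
  shows "cover_measure shift \<U> Z s \<noteq> 0"
proof -
  obtain c where c: "c > 0" "\<And>(J::nat set) w n. Z \<subseteq> (\<Union>i\<in>J. cylinder (n i) (w i)) \<Longrightarrow>
     ennreal c \<le> (\<Sum>\<^sub>\<infinity>i\<in>J. ennreal (exp (- s * real (n i))))"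
    using mass unfolding cylinder_mass_def by blast
  have first: "x 0 = y 0" if "U \<in> \<U>" "x \<in> U" "y \<in> U" for U x y
  proof -
    have "ennreal (seq_dist x y) \<le> cover_diam \<U>"
      unfolding cover_diam_def by (rule SUP_upper2[where i = U]) (use that seq_dist_le_ediam in auto)
    then have "ennreal (seq_dist x y) < 1" using diam by (rule le_less_trans)
    then have "seq_dist x y < exp (- real 0)" by simp
    then show ?thesis unfolding seq_dist_less_exp_iff by (simp add: cylinder_def)
  qed
  have cyl: "\<exists>w. string_set shift u \<subseteq> cylinder (length u) w" if "u \<in> lists \<U>" for u
  proof -
    have "x i = y i" if "x \<in> string_set shift u" "y \<in> string_set shift u" "i < length u" for x y i
    proof -
      have "u ! i \<in> \<U>" using \<open>u \<in> lists \<U>\<close> that by auto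
      then have "((shift ^^ i) x) 0 = ((shift ^^ i) y) 0"
        using that by (intro first) (auto simp: string_set_def)
      then show ?thesis by (simp add: funpow_shift)
    qed
    then show ?thesis unfolding cylinder_def by blast
  qed
  have "ennreal c \<le> cover_premeasure shift \<U> Z s 0"
    unfolding cover_premeasure_def
  proof (rule Inf_greatest, clarify)
    fix G :: "(nat \<Rightarrow> nat) set list set"
    assume G: "countable G" "G \<subseteq> lists \<U>" "Z \<subseteq> (\<Union>u\<in>G. string_set shift u)"
    \<comment> \<open>\<open>cylinder_mass\<close> speaks of index sets of naturals, so the
      countable set of strings is reindexed by its enumeration.\<close>
    define J where "J = to_nat_on G ` G"
    obtain w where w: "\<And>u. u \<in> G \<Longrightarrow> string_set shift u \<subseteq> cylinder (length u) (w u)"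
      using cyl G(2) by (metis subsetD)
    have "Z \<subseteq> (\<Union>u\<in>G. cylinder (length u) (w u))" using G(3) w by blast
    also have "\<dots> = (\<Union>i\<in>J. cylinder (length (from_nat_into G i)) (w (from_nat_into G i)))"
      unfolding J_def using G(1) by simp
    finally have "ennreal c \<le> (\<Sum>\<^sub>\<infinity>i\<in>J. ennreal (exp (- s * real (length (from_nat_into G i)))))"
      using c(2)[of "\<lambda>i. length (from_nat_into G i)" "\<lambda>i. w (from_nat_into G i)" J] by simp
    also have "\<dots> = (\<Sum>\<^sub>\<infinity>u\<in>G. ennreal (exp (- s * real (length u))))"
      unfolding J_def using G(1)
      by (subst infsum_reindex) (auto intro!: infsum_cong simp: inj_on_to_nat_on)
    finally show "ennreal c \<le> (\<Sum>\<^sub>\<infinity>u\<in>G. ennreal (exp (- s * real (length u))))" .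
  qed
  also have "\<dots> \<le> cover_measure shift \<U> Z s"
    unfolding cover_measure_eq_SUP by (rule SUP_upper) simp
  finally show ?thesis using c(1) by (metis ennreal_eq_0_iff le_zero_eq linorder_not_le)
qed

lemma cover_entropy_ge:
  assumes "cylinder_mass Z s" "cover_diam \<U> < 1"
  shows "ereal s \<le> cover_entropy shift \<U> Z"
  unfolding cover_entropy_def
proof (rule Inf_greatest, clarify)
  fix t assume t: "cover_measure shift \<U> Z t = 0"
  have "\<not> t \<le> s"
    using cover_measure_pos[OF cylinder_mass_mono[OF assms(1) _ order_refl] assms(2)] t by blast
  then show "ereal s \<le> ereal t" by simp
qed

end

subsection \<open>Word growth, entropy and dimension of subshifts\<close>

text \<open>Compactness of the full shift: each step fixes one more coordinate by the pigeonhole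
  principle while infinitely many terms of the sequence remain.\<close>

lemma finite_alphabet_cluster_point:
  fixes y :: "nat \<Rightarrow> nat \<Rightarrow> nat"
  assumes "\<And>l i. y l i < d"
  shows "\<exists>x. \<forall>n. infinite {l. y l \<in> cylinder n x}"
proof -
  have "\<exists>f. \<forall>n. infinite {l. y l \<in> cylinder n (f n)} \<and> f (Suc n) \<in> cylinder n (f n)"
  proof (rule dependent_nat_choice)
    show "\<exists>x. infinite {l. y l \<in> cylinder 0 x}" by (simp add: cylinder_def)
  next
    fix x n assume inf: "infinite {l. y l \<in> cylinder n x}"
    have "(\<lambda>l. y l n) ` {l. y l \<in> cylinder n x} \<subseteq> {..<d}" using assms by auto
    then have "finite ((\<lambda>l. y l n) ` {l. y l \<in> cylinder n x})" by (rule finite_subset) simp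
    from pigeonhole_infinite[OF inf this] obtain l0
      where l0: "infinite {l \<in> {l. y l \<in> cylinder n x}. y l n = y l0 n}" by blast
    have "{l \<in> {l. y l \<in> cylinder n x}. y l n = y l0 n} \<subseteq> {l. y l \<in> cylinder (Suc n) (x(n := y l0 n))}"
      by (auto simp: cylinder_def less_Suc_eq)
    with l0 have "infinite {l. y l \<in> cylinder (Suc n) (x(n := y l0 n))}"
      using finite_subset by blast
    moreover have "x(n := y l0 n) \<in> cylinder n x" by (simp add: cylinder_def)
    ultimately show "\<exists>x'. infinite {l. y l \<in> cylinder (Suc n) x'} \<and> x' \<in> cylinder n x" by blast
  qed
  then obtain f where f: "\<And>n. infinite {l. y l \<in> cylinder n (f n)}" "\<And>n. f (Suc n) \<in> cylinder n (f n)"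
    by blast
  \<comment> \<open>Coordinate \<open>i\<close> is final from stage \<open>Suc i\<close> on, since
    later stages agree with earlier ones on their prefix.\<close>
  define x where "x i = f (Suc i) i" for i
  have stable: "f (i + n) \<in> cylinder i (f i)" for i n
  proof (induction n)
    case (Suc n)
    then show ?case using f(2)[of "i + n"] by (simp add: cylinder_def)
  qed (simp add: cylinder_def)
  have *: "f (Suc i + k) i = x i" for i k
    using stable[of "Suc i" k] by (simp add: x_def cylinder_def)
  have "f n i = x i" if "i < n" for n i
    using *[of i "n - Suc i"] that by simp
  then have "cylinder n (f n) = cylinder n x" for n
    by (simp add: cylinder_def)
  then have "infinite {l. y l \<in> cylinder n x}" for n
    using f(1)[of n] by simp
  then show ?thesis by blast
qed

lemma eventually_sequentially_ge_ex:
  assumes "eventually P sequentially" shows "\<exists>n\<ge>m. P (n::nat)"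
proof -
  obtain k where "\<And>n. n \<ge> k \<Longrightarrow> P n" using assms unfolding eventually_sequentially by blast
  then show ?thesis by (intro exI[of _ "max k m"]) simp
qed

lemma ennreal_eq_zeroI:
  fixes x :: ennreal
  assumes "\<And>\<epsilon>. 0 < \<epsilon> \<Longrightarrow> x \<le> ennreal \<epsilon>"
  shows "x = 0"
  using ennreal_le_epsilon[of 0 x] assms by simp

definition word :: "nat \<Rightarrow> (nat \<Rightarrow> nat) \<Rightarrow> nat list" where
  "word n x = map x [0..<n]"

lemma word_eq_iff: "word n x = word n y \<longleftrightarrow> x \<in> cylinder n y"
  by (auto simp: word_def cylinder_def)

text \<open>\<open>closed\<close> is closedness in the space of all sequences, tested on cylinders;
  together with the finite alphabet it makes \<open>X\<close> compact.\<close>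

locale subshift = sequence_space +
  fixes d :: nat
  assumes bounded: "x \<in> X \<Longrightarrow> x i < d"
    and nonempty: "X \<noteq> {}"
    and closed: "(\<And>n. X \<inter> cylinder n x \<noteq> {}) \<Longrightarrow> x \<in> X"
    and shift_closed: "x \<in> X \<Longrightarrow> shift x \<in> X"
begin

lemma funpow_shift_closed: "x \<in> X \<Longrightarrow> (shift ^^ n) x \<in> X"
  by (induction n) (auto simp: shift_closed)

section \<open>Counting words and their exponential growth rate\<close>

definition word_count :: "nat \<Rightarrow> nat" where
  "word_count n = card (word n ` X)"

lemma words_subset: "word n ` X \<subseteq> {w. set w \<subseteq> {..<d} \<and> length w = n}"
  using bounded by (auto simp: word_def)

lemma finite_words: "finite (word n ` X)"
  using words_subset finite_lists_length_eq[of "{..<d}" n] by (auto intro: finite_subset)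

lemma word_count_pos: "word_count n > 0"
  unfolding word_count_def using nonempty finite_words by (simp add: card_gt_0_iff)

lemma word_count_le_power: "word_count n \<le> d ^ n"
  unfolding word_count_def
  using card_mono[OF finite_lists_length_eq words_subset, of n] by (simp add: card_lists_length_eq)

lemma word_count_mono:
  assumes "m \<le> n" shows "word_count m \<le> word_count n"
proof -
  have "word m ` X = take m ` word n ` X"
    using assms by (auto simp: word_def image_image take_map)
  then show ?thesis unfolding word_count_def by (simp add: card_image_le finite_words)
qed

text \<open>Picks a point of \<open>X\<close> for every occurring word; it serves the strings of
  cover elements, the separated sets and the choices in Moran sets.\<close>

lemma exists_word_inverse: "\<exists>r. \<forall>x\<in>X. r (word n x) \<in> X \<and> r (word n x) \<in> cylinder n x"
proof (intro exI ballI)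
  fix x assume "x \<in> X"
  then have "word n x \<in> word n ` X" by blast
  from inv_into_into[OF this] f_inv_into_f[OF this]
  show "inv_into X (word n) (word n x) \<in> X \<and> inv_into X (word n) (word n x) \<in> cylinder n x"
    by (simp add: word_eq_iff)
qed

text \<open>This is the limit superior of \<open>ln (word_count n) / n\<close>, written as the
  infimum of the exponents that eventually bound the counts.\<close>

definition growth :: real where
  "growth = Inf {s. \<forall>\<^sub>F n in sequentially. real (word_count n) \<le> exp (s * real n)}"

lemma word_count_le_exp_nonneg:
  assumes "\<forall>\<^sub>F n in sequentially. real (word_count n) \<le> exp (s * real n)"
  shows "0 \<le> s"
proof -
  from assms obtain n where n: "n \<ge> 1" "real (word_count n) \<le> exp (s * real n)"
    using eventually_sequentially_ge_ex by blast
  have "1 \<le> real (word_count n)" using word_count_pos[of n] by simp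
  then have "1 \<le> exp (s * real n)" using n by linarith
  then have "0 \<le> s * real n" by simp
  then show ?thesis using n by (simp add: zero_le_mult_iff)
qed

text \<open>Supplies an admissible exponent, while \<open>word_count_le_exp_nonneg\<close> gives the
  lower bound 0; so the infimum in \<open>growth\<close> is taken over a nonempty set bounded
  below.\<close>

lemma word_count_le_exp_ln: "real (word_count n) \<le> exp (ln (real d) * real n)"
proof -
  have "d > 0" using nonempty bounded by fastforce
  then have "exp (ln (real d) * real n) = real (d ^ n)"
    by (simp add: exp_of_nat2_mult)
  then show ?thesis using word_count_le_power[of n] by linarith
qed

lemma growth_nonneg: "0 \<le> growth"
  unfolding growth_def
  by (rule cInf_greatest) (use word_count_le_exp_ln word_count_le_exp_nonneg in \<open>auto intro!: always_eventually\<close>)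

lemma word_count_le_exp:
  assumes "growth < s"
  shows "\<forall>\<^sub>F n in sequentially. real (word_count n) \<le> exp (s * real n)"
proof -
  obtain t where t: "\<forall>\<^sub>F n in sequentially. real (word_count n) \<le> exp (t * real n)" "t < s"
    using cInf_lessD[OF _ assms[unfolded growth_def]] word_count_le_exp_ln
    by (force intro!: always_eventually)
  have "exp (t * real n) \<le> exp (s * real n)" for n
    using t(2) by (simp add: mult_right_mono)
  then show ?thesis using t(1) by (auto elim!: eventually_mono intro: order_trans)
qed

lemma word_count_ge_exp:
  assumes "s < growth"
  shows "\<exists>\<^sub>F n in sequentially. exp (s * real n) < real (word_count n)"
proof (rule ccontr)
  assume "\<not> ?thesis"
  then have "\<forall>\<^sub>F n in sequentially. real (word_count n) \<le> exp (s * real n)"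
    by (simp add: not_frequently not_less)
  moreover have "bdd_below {s. \<forall>\<^sub>F n in sequentially. real (word_count n) \<le> exp (s * real n)}"
    using word_count_le_exp_nonneg by (auto intro!: bdd_belowI[of _ 0])
  ultimately have "growth \<le> s" unfolding growth_def by (intro cInf_lower) auto
  then show False using assms by simp
qed

lemma eventually_exp_le:
  assumes "t < s" "0 < \<epsilon>"
  shows "\<forall>\<^sub>F n in sequentially. exp (t * (real n + c)) \<le> \<epsilon> * exp (s * real n)"
proof -
  have "\<forall>\<^sub>F n in sequentially. (t * c - ln \<epsilon>) / (s - t) \<le> real n"
    using filterlim_real_sequentially unfolding filterlim_at_top by blast
  then show ?thesis
  proof eventually_elim
    case (elim n)
    then have "t * (real n + c) \<le> ln \<epsilon> + s * real n"
      using assms by (simp add: divide_le_eq algebra_simps)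
    then have "exp (t * (real n + c)) \<le> exp (ln \<epsilon> + s * real n)" by simp
    also have "\<dots> = \<epsilon> * exp (s * real n)" using assms by (simp add: exp_add)
    finally show ?case .
  qed
qed

text \<open>The gap between \<open>growth\<close> and \<open>s\<close> absorbs both a fixed
  extension of the words and a constant factor. It serves the dimension with \<open>l = 0\<close>,
  and the entropy with \<open>l\<close> the resolution of a cover or of separated points.\<close>

lemma word_count_eventually_less:
  assumes "growth < s" "0 < \<epsilon>"
  shows "\<forall>\<^sub>F n in sequentially. real (word_count (n + l)) \<le> \<epsilon> * exp (s * real n)"
proof -
  obtain t where t: "growth < t" "t < s" using dense assms by blast
  have "\<forall>\<^sub>F n in sequentially. real (word_count (n + l)) \<le> exp (t * real (n + l))"
    using word_count_le_exp[OF t(1)]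
    by (rule eventually_sequentially_seg[where P = "\<lambda>n. real (word_count n) \<le> exp (t * real n)", THEN iffD2])
  then show ?thesis using eventually_exp_le[OF t(2) assms(2), of "real l"]
    by eventually_elim simp
qed

section \<open>Upper bounds for dimension and entropy by counting words\<close>

lemma hausdorff_measure_zero:
  assumes "growth < s" "Z \<subseteq> X"
  shows "hausdorff_measure s Z = 0"
proof -
  have s: "0 < s" using growth_nonneg assms by linarith
  have "hausdorff_premeasure s \<delta> Z \<le> ennreal \<epsilon>" if \<delta>: "0 < \<delta>" and \<epsilon>: "0 < \<epsilon>" for \<delta> \<epsilon>
  proof -
    obtain n0 where n0: "exp (- real n0) < \<delta>" using exists_exp_less[of \<delta>] \<delta> by blast
    obtain n where n: "n \<ge> n0" "real (word_count n) \<le> \<epsilon> * exp (s * real n)"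
      using eventually_sequentially_ge_ex[OF word_count_eventually_less[OF assms(1) \<epsilon>, of 0], of n0]
      by auto
    have "exp (- real n) \<le> exp (- real n0)" using n(1) by simp
    then have n1: "exp (- real n) \<le> \<delta>" using n0 by linarith
    obtain g where g: "bij_betw g {..<word_count n} (word n ` X)"
      unfolding word_count_def using ex_bij_betw_nat_finite[OF finite_words] by (auto simp: atLeast0LessThan)
    \<comment> \<open>The cylinders of length \<open>n\<close> that meet \<open>X\<close>, one for
      each word. Past the last word the sets are empty and cost \<open>0 powr s\<close>, which is 0
      in HOL.\<close>
    define C where "C i = (if i < word_count n then {x\<in>X. word n x = g i} else {})" for i
    have diam: "ediam (C i) \<le> ennreal (exp (- real n))" for i
      by (rule ediam_le_exp) (auto simp: C_def word_eq_iff[symmetric] split: if_splits)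
    have "Z \<subseteq> (\<Union>i. C i)"
    proof
      fix x assume "x \<in> Z"
      then have "x \<in> X" using assms by blast
      then have "word n x \<in> g ` {..<word_count n}" using g by (simp add: bij_betw_def)
      then obtain i where "i < word_count n" "word n x = g i" by blast
      then show "x \<in> (\<Union>i. C i)" using \<open>x \<in> X\<close> by (auto simp: C_def intro!: exI[of _ i])
    qed
    moreover have "C i \<subseteq> X" "ediam (C i) \<le> ennreal \<delta>" for i
      using order_trans[OF diam[of i] ennreal_leI[OF n1]] by (auto simp: C_def)
    ultimately have "hausdorff_premeasure s \<delta> Z \<le> (\<Sum>i. ennreal (enn2real (ediam (C i)) powr s))"
      unfolding hausdorff_premeasure_def by (intro Inf_lower) blast
    also have "\<dots> = (\<Sum>i<word_count n. ennreal (enn2real (ediam (C i)) powr s))"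
      by (intro suminf_finite) (auto simp: C_def ediam_def bot_ennreal)
    also have "\<dots> \<le> (\<Sum>i<word_count n. ennreal (exp (- s * real n)))"
    proof (intro sum_mono ennreal_leI)
      fix i
      have "enn2real (ediam (C i)) \<le> exp (- real n)"
        using enn2real_mono[OF diam] by simp
      then have "enn2real (ediam (C i)) powr s \<le> exp (- real n) powr s"
        using s by (intro powr_mono2) auto
      then show "enn2real (ediam (C i)) powr s \<le> exp (- s * real n)" by (simp add: powr_def)
    qed
    also have "\<dots> = ennreal (real (word_count n) * exp (- s * real n))"
      by (simp add: ennreal_mult ennreal_of_nat_eq_real_of_nat)
    also have "\<dots> \<le> ennreal (\<epsilon> * exp (s * real n) * exp (- s * real n))"
      using n(2) by (intro ennreal_leI mult_right_mono) auto
    also have "\<dots> = ennreal \<epsilon>" by (simp add: mult.assoc exp_add[symmetric])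
    finally show ?thesis .
  qed
  then have "hausdorff_premeasure s \<delta> Z = 0" if "0 < \<delta>" for \<delta>
    using that by (blast intro: ennreal_eq_zeroI)
  then show ?thesis unfolding hausdorff_measure_def by simp
qed

lemma hausdorff_dim_le_growth:
  assumes "Z \<subseteq> X" shows "hausdorff_dim Z \<le> ereal growth"
proof (rule ccontr)
  assume "\<not> ?thesis"
  then have "ereal growth < hausdorff_dim Z" by (simp add: not_le)
  then obtain s where "ereal growth < ereal s" and s2: "ereal s < hausdorff_dim Z"
    using ereal_dense2 by blast
  then have s: "growth < s" by simp
  have "hausdorff_dim Z \<le> ereal s"
    unfolding hausdorff_dim_def
    by (intro Inf_lower) (use s hausdorff_measure_zero[OF s assms] growth_nonneg in auto)
  then show False using s2 by simp
qed

text \<open>A Lebesgue number in terms of cylinders. If every length \<open>l\<close> failed at some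
  \<open>y l\<close>, a cluster point would lie in \<open>X\<close>, and a cylinder around it inside
  a member of the cover would contain the cylinder of some \<open>y l\<close>.\<close>

lemma cylinder_cover_number:
  assumes "\<U> \<in> open_covers"
  shows "\<exists>l. \<forall>x\<in>X. \<exists>U\<in>\<U>. X \<inter> cylinder l x \<subseteq> U"
proof (rule ccontr)
  assume "\<not> ?thesis"
  then have "\<exists>y. y \<in> X \<and> (\<forall>U\<in>\<U>. \<not> X \<inter> cylinder l y \<subseteq> U)" for l
    by blast
  then obtain y where y: "\<And>l. y l \<in> X" "\<And>l U. U \<in> \<U> \<Longrightarrow> \<not> X \<inter> cylinder l (y l) \<subseteq> U"
    by metis
  obtain x where x: "\<And>n. infinite {l. y l \<in> cylinder n x}"
    using finite_alphabet_cluster_point[of y d] y(1) bounded by blast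
  have "X \<inter> cylinder n x \<noteq> {}" for n
  proof -
    obtain l where "y l \<in> cylinder n x" using infinite_imp_nonempty[OF x[of n]] by blast
    then show ?thesis using y(1) by blast
  qed
  then have "x \<in> X" by (rule closed)
  then obtain U where U: "U \<in> \<U>" "x \<in> U" using assms by (auto simp: open_covers_def)
  then obtain n where n: "X \<inter> cylinder n x \<subseteq> U"
    using openin_cylinderD[of U x] assms by (auto simp: open_covers_def)
  obtain l where l: "l \<ge> n" "y l \<in> cylinder n x"
    using x[of n] unfolding infinite_nat_iff_unbounded_le by blast
  have "cylinder l (y l) \<subseteq> cylinder n x" using l by (auto simp: cylinder_def)
  then show False using n y(2)[OF U(1), of l] by blast
qed

text \<open>A word of length \<open>m + l\<close> determines, at each of the first \<open>m\<close>
  times, the next \<open>l\<close> coordinates and so a member of the cover. Hence at most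
  \<open>word_count (m + l)\<close> strings of length \<open>m\<close> suffice.\<close>

lemma cover_measure_zero:
  assumes "growth < s" "Z \<subseteq> X" "\<U> \<in> open_covers"
  shows "cover_measure shift \<U> Z s = 0"
proof -
  obtain l where l: "\<And>x. x \<in> X \<Longrightarrow> \<exists>U\<in>\<U>. X \<inter> cylinder l x \<subseteq> U"
    using cylinder_cover_number[OF assms(3)] by blast
  then obtain V where V: "\<And>x. x \<in> X \<Longrightarrow> V x \<in> \<U> \<and> X \<inter> cylinder l x \<subseteq> V x" by metis
  have "cover_premeasure shift \<U> Z s n \<le> ennreal \<epsilon>" if \<epsilon>: "0 < \<epsilon>" for n \<epsilon>
  proof -
    obtain m where m: "m \<ge> n" "real (word_count (m + l)) \<le> \<epsilon> * exp (s * real m)"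
      using eventually_sequentially_ge_ex[OF word_count_eventually_less[OF assms(1) \<epsilon>, of l]]
      by blast
    obtain r where r: "\<And>x. x \<in> X \<Longrightarrow> r (word (m + l) x) \<in> X"
        "\<And>x. x \<in> X \<Longrightarrow> r (word (m + l) x) \<in> cylinder (m + l) x"
      using exists_word_inverse[of "m + l"] by blast
    define g where "g w = map (\<lambda>j. V ((shift ^^ j) (r w))) [0..<m]" for w
    define G where "G = g ` word (m + l) ` X"
    have fin: "finite G" unfolding G_def using finite_words by simp
    have len: "length u = m" if "u \<in> G" for u using that by (auto simp: G_def g_def)
    have "G \<subseteq> lists \<U>"
      unfolding G_def g_def using V r(1) funpow_shift_closed by (auto simp: lists_eq_set)
    moreover have "Z \<subseteq> (\<Union>u\<in>G. string_set shift u)"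
    proof
      fix x assume "x \<in> Z"
      then have x: "x \<in> X" using assms by blast
      have "(shift ^^ j) x \<in> V ((shift ^^ j) (r (word (m + l) x)))" if "j < m" for j
      proof -
        have "(shift ^^ j) x \<in> cylinder l ((shift ^^ j) (r (word (m + l) x)))"
          using r(2)[OF x] that by (auto simp: cylinder_def funpow_shift)
        then show ?thesis using V r(1)[OF x] funpow_shift_closed x by blast
      qed
      then have "x \<in> string_set shift (g (word (m + l) x))"
        using x by (simp add: string_set_def g_def)
      then show "x \<in> (\<Union>u\<in>G. string_set shift u)" using x unfolding G_def by blast
    qed
    ultimately have "cover_premeasure shift \<U> Z s n
        \<le> (\<Sum>\<^sub>\<infinity>u\<in>G. ennreal (exp (- s * real (length u))))"
      unfolding cover_premeasure_def using fin len m(1)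
      by (intro Inf_lower) (auto intro!: exI[of _ G] countable_finite)
    also have "\<dots> = (\<Sum>u\<in>G. ennreal (exp (- s * real m)))"
      using fin len by (simp add: sum.cong)
    also have "\<dots> = ennreal (real (card G) * exp (- s * real m))"
      by (simp add: ennreal_mult ennreal_of_nat_eq_real_of_nat)
    also have "\<dots> \<le> ennreal (\<epsilon> * exp (s * real m) * exp (- s * real m))"
    proof (intro ennreal_leI mult_right_mono)
      have "card G \<le> word_count (m + l)"
        unfolding G_def word_count_def by (intro card_image_le finite_words)
      then show "real (card G) \<le> \<epsilon> * exp (s * real m)" using m(2) by linarith
    qed simp
    also have "\<dots> = ennreal \<epsilon>" by (simp add: mult.assoc exp_add[symmetric])
    finally show ?thesis .
  qed
  then have "cover_premeasure shift \<U> Z s n = 0" for n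
    by (blast intro: ennreal_eq_zeroI)
  then show ?thesis unfolding cover_measure_eq_SUP by simp
qed

lemma cover_entropy_le_growth:
  assumes "Z \<subseteq> X" "\<U> \<in> open_covers" shows "cover_entropy shift \<U> Z \<le> ereal growth"
proof (rule ccontr)
  assume "\<not> ?thesis"
  then have "ereal growth < cover_entropy shift \<U> Z" by (simp add: not_le)
  then obtain s where "ereal growth < ereal s" and s2: "ereal s < cover_entropy shift \<U> Z"
    using ereal_dense2 by blast
  then have s: "growth < s" by simp
  have "cover_entropy shift \<U> Z \<le> ereal s"
    unfolding cover_entropy_def
    by (intro Inf_lower) (use cover_measure_zero[OF s assms] in auto)
  then show False using s2 by simp
qed

end

lemma ereal_le_of_all_less:
  assumes "\<And>s. s < h \<Longrightarrow> ereal s \<le> y" shows "ereal h \<le> y"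
proof (rule ccontr)
  assume "\<not> ?thesis"
  then have "y < ereal h" by (simp add: not_le)
  then obtain s where "y < ereal s" "ereal s < ereal h" using ereal_dense2 by blast
  then show False using assms[of s] by simp
qed

section \<open>Bowen entropy and cover entropy as the growth rate of words\<close>

context subshift
begin

text \<open>Points with equal words of length \<open>n + l\<close> stay within
  \<open>exp (- l)\<close> of each other for the first \<open>n\<close> iterates, so the points of a
  separated set have distinct words.\<close>

lemma separated_card_le:
  assumes "separated shift n \<epsilon> E" "exp (- real l) \<le> \<epsilon>"
  shows "card E \<le> word_count (n + l)"
proof -
  have "inj_on (word (n + l)) E"
  proof (rule inj_onI, rule ccontr)
    fix x y assume xy: "x \<in> E" "y \<in> E" "word (n + l) x = word (n + l) y" "x \<noteq> y"
    then obtain j where j: "j < n" "\<epsilon> < seq_dist ((shift ^^ j) x) ((shift ^^ j) y)"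
      using assms(1) unfolding separated_def by blast
    have "(shift ^^ j) y \<in> cylinder l ((shift ^^ j) x)"
      using xy(3) j(1) by (auto simp: word_eq_iff cylinder_def funpow_shift)
    then have "seq_dist ((shift ^^ j) x) ((shift ^^ j) y) \<le> exp (- real l)"
      by (simp only: seq_dist_le_exp_iff)
    then show False using j(2) assms(2) by linarith
  qed
  then have "card E = card (word (n + l) ` E)" by (simp add: card_image)
  also have "\<dots> \<le> word_count (n + l)"
    unfolding word_count_def using assms(1)
    by (intro card_mono finite_words image_mono) (simp add: separated_def)
  finally show ?thesis .
qed

text \<open>Different words of length \<open>n\<close> differ at some time \<open>j < n\<close>, and
  then the iterates at that time have distance 1. One point per word is thus separated at every
  scale below 1.\<close>

lemma exists_separated:
  assumes "\<epsilon> < 1"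
  shows "\<exists>E. separated shift n \<epsilon> E \<and> card E = word_count n"
proof -
  obtain r where r: "\<forall>x\<in>X. r (word n x) \<in> X \<and> r (word n x) \<in> cylinder n x"
    using exists_word_inverse[of n] by blast
  define E where "E = r ` word n ` X"
  have word_r: "word n (r w) = w" if w: "w \<in> word n ` X" for w
  proof -
    obtain x where "x \<in> X" "w = word n x" using w by blast
    then show ?thesis using r by (simp add: word_eq_iff)
  qed
  have "card E = word_count n"
    unfolding E_def word_count_def
    by (rule card_image, rule inj_on_inverseI[where g = "word n"], rule word_r)
  moreover have "separated shift n \<epsilon> E"
    unfolding separated_def
  proof (intro conjI ballI impI)
    show "finite E" unfolding E_def by (intro finite_imageI finite_words)
    show "E \<subseteq> X" unfolding E_def using r by auto
    fix x y assume xy: "x \<in> E" "y \<in> E" "x \<noteq> y"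
    have "r (word n x') = x'" if "x' \<in> E" for x'
      using that word_r unfolding E_def by force
    from this[OF xy(1)] this[OF xy(2)] xy(3) have "word n x \<noteq> word n y"
      by metis
    then have "x \<notin> cylinder n y" by (simp add: word_eq_iff)
    then obtain j where j: "j < n" "x j \<noteq> y j" unfolding cylinder_def by blast
    then have "(shift ^^ j) y \<notin> cylinder (Suc 0) ((shift ^^ j) x)"
      by (simp add: cylinder_def funpow_shift)
    then have "\<not> seq_dist ((shift ^^ j) x) ((shift ^^ j) y) < exp (- real 0)"
      unfolding seq_dist_less_exp_iff .
    then show "\<exists>j<n. \<epsilon> < seq_dist ((shift ^^ j) x) ((shift ^^ j) y)"
      using j(1) assms by (intro exI[of _ j]) simp
  qed
  ultimately show ?thesis by blast
qed

text \<open>The value does not depend on \<epsilon> in (0, 1), so the outer limit in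
  \<open>topological_entropy\<close> is that of an eventually constant function.\<close>

lemma limsup_separated:
  assumes "0 < \<epsilon>" "\<epsilon> < 1"
  shows "limsup (\<lambda>n. SUP E\<in>{E. separated shift n \<epsilon> E}. ereal (ln (real (card E)) / real n)) = ereal growth"
    (is "limsup ?f = _")
proof (rule antisym)
  obtain l where l: "exp (- real l) < \<epsilon>" using exists_exp_less[of \<epsilon>] assms by blast
  show "limsup ?f \<le> ereal growth"
  proof (rule ccontr)
    assume "\<not> ?thesis"
    then have "ereal growth < limsup ?f" by (simp add: not_le)
    then obtain s where "ereal growth < ereal s" and s2: "ereal s < limsup ?f"
      using ereal_dense2 by blast
    then have s: "growth < s" by simp
    have "\<forall>\<^sub>F n in sequentially. real (word_count (n + l)) \<le> exp (s * real n)"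
      using word_count_eventually_less[OF s, of 1 l] by simp
    then have "\<forall>\<^sub>F n in sequentially. ?f n \<le> ereal s"
      using eventually_ge_at_top[of 1]
    proof eventually_elim
      case (elim n)
      show ?case
      proof (rule SUP_least)
        fix E assume E: "E \<in> {E. separated shift n \<epsilon> E}"
        have "ln (real (card E)) \<le> s * real n"
        proof (cases "card E = 0")
          \<comment> \<open>The empty set counts as separated; \<open>ln 0\<close> is 0 in HOL and
            stays below the bound because \<open>s\<close> is positive.\<close>
          case True
          then show ?thesis using s growth_nonneg by simp
        next
          case False
          have "card E \<le> word_count (n + l)"
            using separated_card_le[of n \<epsilon> E l] E l by simp
          then have "real (card E) \<le> exp (s * real n)" using elim(1) by linarith
          then have "ln (real (card E)) \<le> ln (exp (s * real n))" using False by (intro ln_mono) auto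
          then show ?thesis by simp
        qed
        then show "ereal (ln (real (card E)) / real n) \<le> ereal s"
          using elim(2) by (simp add: divide_le_eq)
      qed
    qed
    then have "limsup ?f \<le> ereal s" by (rule Limsup_bounded)
    then show False using s2 by simp
  qed
  show "ereal growth \<le> limsup ?f"
  proof (rule ccontr)
    assume "\<not> ?thesis"
    then have "limsup ?f < ereal growth" by (simp add: not_le)
    then obtain s where s1: "limsup ?f < ereal s" and "ereal s < ereal growth"
      using ereal_dense2 by blast
    then have s: "s < growth" by simp
    have "\<forall>\<^sub>F n in sequentially. \<not> exp (s * real n) < real (word_count n)"
      using Limsup_lessD[OF s1] eventually_ge_at_top[of 1]
    proof eventually_elim
      case (elim n)
      obtain E where E: "separated shift n \<epsilon> E" "card E = word_count n"
        using exists_separated[OF assms(2)] by blast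
      have "ereal (ln (real (card E)) / real n) \<le> ?f n" using E by (intro SUP_upper) simp
      also have "\<dots> < ereal s" by (rule elim(1))
      finally have "ln (real (word_count n)) < s * real n"
        using elim(2) E(2) by (simp add: divide_less_eq)
      then have "exp (ln (real (word_count n))) < exp (s * real n)" by simp
      then show ?case using word_count_pos[of n] by simp
    qed
    then show False using word_count_ge_exp[OF s] by (simp add: frequently_def)
  qed
qed

lemma topological_entropy_eq_growth: "topological_entropy shift = ereal growth"
  unfolding topological_entropy_def
proof (intro tendsto_Lim tendsto_eventually)
  have "\<forall>\<^sub>F \<epsilon> in at_right (0::real). 0 < \<epsilon> \<and> \<epsilon> < 1"
    by (rule eventually_at_rightI[of 0 1]) auto
  then show "\<forall>\<^sub>F \<epsilon> in at_right 0. limsup (\<lambda>n. SUP E\<in>{E. separated shift n \<epsilon> E}.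
      ereal (ln (real (card E)) / real n)) = ereal growth"
    by eventually_elim (rule limsup_separated, auto)
qed simp

text \<open>Makes the filter in \<open>entropy_on\<close> proper, so that \<open>Lim\<close> denotes
  the actual limit: the covers by cylinders of length \<open>n\<close> have diameters tending to
  0.\<close>

lemma exists_fine_cover:
  assumes "open S" "(0::ennreal) \<in> S"
  shows "\<exists>\<U>\<in>open_covers. cover_diam \<U> \<in> S"
proof -
  define \<U> where "\<U> n = (\<lambda>x. X \<inter> cylinder n x) ` X" for n
  have cover: "\<U> n \<in> open_covers" for n
  proof -
    have "openin mtopology (X \<inter> cylinder n x)" for x
      by (rule openin_cylinderI, blast, rule exI[of _ n]) (simp add: cylinder_def subset_iff)
    moreover have "x \<in> cylinder n x" for x by (simp add: cylinder_def)
    ultimately show ?thesis unfolding open_covers_def \<U>_def by blast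
  qed
  have le: "cover_diam (\<U> n) \<le> ennreal (exp (- real n))" for n
    unfolding cover_diam_def \<U>_def
  proof (rule SUP_least, elim imageE)
    fix U x assume "U = X \<inter> cylinder n x"
    then show "ediam U \<le> ennreal (exp (- real n))"
      by (intro ediam_le_exp) (simp add: cylinder_def)
  qed
  have "(\<lambda>n. ennreal (exp (- real n))) \<longlonglongrightarrow> ennreal 0"
    by (intro tendsto_ennrealI filterlim_compose[OF exp_at_bot])
      (simp add: filterlim_uminus_at_bot filterlim_real_sequentially)
  then have lim: "(\<lambda>n. ennreal (exp (- real n))) \<longlonglongrightarrow> 0" by (simp only: ennreal_0)
  have "(\<lambda>n. cover_diam (\<U> n)) \<longlonglongrightarrow> 0"
    by (rule tendsto_sandwich[OF _ _ tendsto_const[of 0] lim]) (simp_all add: le)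
  then have "\<forall>\<^sub>F n in sequentially. cover_diam (\<U> n) \<in> S"
    using assms by (rule topological_tendstoD)
  then obtain n where "cover_diam (\<U> n) \<in> S"
    using eventually_sequentially_ge_ex[of "\<lambda>n. cover_diam (\<U> n) \<in> S" 0] by blast
  then show ?thesis using cover[of n] by (rule bexI)
qed

text \<open>Mass gives the lower bound for every cover of diameter below 1, word counting the upper
  one for every open cover; so the function under the limit is eventually constant.\<close>

lemma entropy_on_eq_growth:
  assumes "Z \<subseteq> X" and mass: "\<And>s. s < growth \<Longrightarrow> cylinder_mass Z s"
  shows "entropy_on shift Z = ereal growth"
  unfolding entropy_on_def
proof (intro tendsto_Lim tendsto_eventually)
  let ?F = "inf (filtercomap cover_diam (nhds 0)) (principal open_covers)"
  show "?F \<noteq> bot"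
  proof
    assume "?F = bot"
    then have "eventually (\<lambda>_. False) ?F" by simp
    then obtain S where S: "open S" "0 \<in> S" "\<And>\<U>. cover_diam \<U> \<in> S \<Longrightarrow> \<U> \<notin> open_covers"
      unfolding eventually_inf_principal eventually_filtercomap_nhds by blast
    then show False using exists_fine_cover[OF S(1,2)] by blast
  qed
  have "\<forall>\<^sub>F \<U> in ?F. cover_diam \<U> < 1 \<and> \<U> \<in> open_covers"
    unfolding eventually_inf_principal eventually_filtercomap_nhds
    by (rule exI[of _ "{..<1}"]) simp
  then show "\<forall>\<^sub>F \<U> in ?F. cover_entropy shift \<U> Z = ereal growth"
  proof eventually_elim
    case (elim \<U>)
    show ?case
    proof (rule antisym)
      show "cover_entropy shift \<U> Z \<le> ereal growth"
        using elim by (intro cover_entropy_le_growth assms(1)) blast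
      have "ereal s \<le> cover_entropy shift \<U> Z" if "s < growth" for s
        using elim by (intro cover_entropy_ge mass[OF that]) blast
      then show "ereal growth \<le> cover_entropy shift \<U> Z"
        by (rule ereal_le_of_all_less)
    qed
  qed
qed

lemma hausdorff_dim_eq_growth:
  assumes "Z \<subseteq> X" and "\<And>s. s < growth \<Longrightarrow> cylinder_mass Z s"
  shows "hausdorff_dim Z = ereal growth"
proof (rule antisym)
  show "hausdorff_dim Z \<le> ereal growth" by (rule hausdorff_dim_le_growth[OF assms(1)])
  show "ereal growth \<le> hausdorff_dim Z"
    by (rule ereal_le_of_all_less, rule hausdorff_dim_ge, rule assms(2))
qed

end

subsection \<open>Paths in a mixing subshift of finite type\<close>

text \<open>A path of length \<open>n\<close> has \<open>n + 1\<close> states. The last state of the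
  first path is dropped because it is the first state of the second.\<close>

definition join :: "nat \<Rightarrow> (nat \<Rightarrow> nat) \<Rightarrow> (nat \<Rightarrow> nat) \<Rightarrow> nat \<Rightarrow> nat" where
  "join n f g = (\<lambda>i. if i < n then f i else g (i - n))"

definition concat_loops :: "nat \<Rightarrow> (nat \<Rightarrow> nat \<Rightarrow> nat) \<Rightarrow> nat \<Rightarrow> nat" where
  "concat_loops l g = (\<lambda>i. g (i div l) (i mod l))"

lemma concat_loops_block: "j < l \<Longrightarrow> concat_loops l g (i * l + j) = g i j"
  by (simp add: concat_loops_def)

text \<open>One exponent \<open>k\<close> of aperiodicity is fixed; it is the common length of all
  connecting paths.\<close>

locale mixing_sft =
  fixes A :: "nat mat" and d k :: nat
  assumes carrier: "A \<in> carrier_mat d d"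
    and zero_one: "elements_mat A \<subseteq> {0, 1}"
    and two_states: "d \<ge> 2"
    and k_pos: "k \<ge> 1"
    and power_pos: "\<And>i j. i < d \<Longrightarrow> j < d \<Longrightarrow> (A ^\<^sub>m k) $$ (i, j) > 0"
begin

definition path :: "nat \<Rightarrow> nat \<Rightarrow> nat \<Rightarrow> (nat \<Rightarrow> nat) \<Rightarrow> bool" where
  "path n a b f \<longleftrightarrow> f 0 = a \<and> f n = b \<and> (\<forall>i\<le>n. f i < d) \<and> (\<forall>i<n. A $$ (f i, f (Suc i)) = 1)"

lemma dim_A: "dim_row A = d" using carrier by auto

lemma entry_pos_eq_one:
  assumes "i < d" "j < d" "A $$ (i, j) > 0" shows "A $$ (i, j) = 1"
proof -
  have "A $$ (i, j) \<in> elements_mat A" using assms carrier by (auto intro: elements_matI)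
  then show ?thesis using zero_one assms(3) by auto
qed

text \<open>The entries of a matrix power are sums over intermediate states; a positive sum has a
  nonzero term, which supplies a shorter path and the last edge.\<close>

lemma path_of_power_pos:
  assumes "i < d" "j < d" "(A ^\<^sub>m n) $$ (i, j) > 0"
  shows "\<exists>f. path n i j f"
  using assms(2,3)
proof (induction n arbitrary: j)
  case 0
  then have "i = j" using assms(1) carrier by (cases "i = j") auto
  then show ?case using assms(1) by (intro exI[of _ "\<lambda>_. i"]) (simp add: path_def)
next
  case (Suc n)
  have An: "A ^\<^sub>m n \<in> carrier_mat d d" using carrier by (rule pow_carrier_mat)
  have "(A ^\<^sub>m Suc n) $$ (i, j) = (\<Sum>l = 0..<d. (A ^\<^sub>m n) $$ (i, l) * A $$ (l, j))"
    using An carrier assms(1) Suc.prems(1) by (simp add: scalar_prod_def)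
  then have "0 < (\<Sum>l = 0..<d. (A ^\<^sub>m n) $$ (i, l) * A $$ (l, j))"
    using Suc.prems(2) by (simp only:)
  then have "(\<Sum>l = 0..<d. (A ^\<^sub>m n) $$ (i, l) * A $$ (l, j)) \<noteq> 0"
    by (rule less_imp_neq[THEN not_sym])
  then obtain l where l: "l < d" "(A ^\<^sub>m n) $$ (i, l) * A $$ (l, j) \<noteq> 0"
    by (meson atLeastLessThan_iff sum.neutral)
  then obtain f where f: "path n i l f" using Suc.IH[of l] by auto
  have "A $$ (l, j) = 1" using l Suc.prems entry_pos_eq_one by simp
  then have "path (Suc n) i j (f(Suc n := j))"
    using f Suc.prems unfolding path_def by (auto simp: less_Suc_eq le_Suc_eq)
  then show ?case by blast
qed

definition connection :: "nat \<Rightarrow> nat \<Rightarrow> nat \<Rightarrow> nat" where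
  "connection a b = (SOME f. path k a b f)"

lemma path_connection: "a < d \<Longrightarrow> b < d \<Longrightarrow> path k a b (connection a b)"
  unfolding connection_def using someI_ex[OF path_of_power_pos[OF _ _ power_pos]] .

lemma path_join:
  assumes "path m a b f" "path n b c g" shows "path (m + n) a c (join m f g)"
proof -
  have "A $$ (join m f g i, join m f g (Suc i)) = 1" if "i < m + n" for i
  proof -
    consider "Suc i < m" | "Suc i = m" | "m \<le> i" by linarith
    then show ?thesis
    proof cases
      case 1
      then show ?thesis using assms by (simp add: path_def join_def)
    next
      case 2
      then have "A $$ (f i, f (Suc i)) = 1" "f (Suc i) = g 0" using assms by (auto simp: path_def)
      then show ?thesis using 2 by (auto simp: join_def)
    next
      case 3
      then show ?thesis using assms that by (simp add: path_def join_def Suc_diff_le)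
    qed
  qed
  moreover have "join m f g i < d" if "i \<le> m + n" for i
    using assms that by (auto simp: path_def join_def)
  moreover have "join m f g 0 = a" using assms by (cases "m = 0") (auto simp: path_def join_def)
  moreover have "join m f g (m + n) = c" using assms by (auto simp: path_def join_def)
  ultimately show ?thesis by (simp add: path_def)
qed

lemma in_sft_iff: "x \<in> sft A \<longleftrightarrow> (\<forall>i. x i < d \<and> A $$ (x i, x (Suc i)) = 1)"
  by (simp add: sft_def dim_A)

lemma path_of_sft: "x \<in> sft A \<Longrightarrow> path n (x 0) (x n) x"
  by (simp add: in_sft_iff path_def)

lemma in_sft_of_paths:
  assumes "\<And>n. path n (x 0) (x n) x" shows "x \<in> sft A"
  using assms unfolding in_sft_iff path_def by (metis le_refl lessI)

lemma join_in_sft: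
  assumes "path n a b f" "y \<in> sft A" "y 0 = b" shows "join n f y \<in> sft A"
proof (rule in_sft_of_paths)
  fix m
  have "path n a (y 0) f" using assms by simp
  from path_join[OF this path_of_sft[OF assms(2)], of m]
  have "path (n + m) a (y m) (join n f y)" .
  then show "path m (join n f y 0) (join n f y m) (join n f y)"
    by (auto simp: path_def)
qed

lemma concat_loops_in_sft:
  assumes "0 < l" and loops: "\<And>i. path l a a (g i)"
  shows "concat_loops l g \<in> sft A"
  unfolding in_sft_iff
proof (intro allI conjI)
  fix i
  have mod: "i mod l < l" using assms(1) by simp
  show "concat_loops l g i < d"
    using loops[of "i div l"] mod by (simp add: concat_loops_def path_def)
  \<comment> \<open>At the end of a block the next loop starts in \<open>a\<close>, where the
    current loop ends; so the successor can always be read off the current loop.\<close>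
  have "concat_loops l g (Suc i) = g (i div l) (Suc (i mod l))"
  proof (cases "Suc (i mod l) = l")
    case True
    then have "concat_loops l g (Suc i) = g (Suc (i div l)) 0"
      by (simp add: concat_loops_def mod_Suc div_Suc)
    also have "\<dots> = g (i div l) l" using loops by (simp add: path_def)
    finally show ?thesis using True by simp
  next
    case False
    then show ?thesis by (simp add: concat_loops_def mod_Suc div_Suc)
  qed
  then show "A $$ (concat_loops l g i, concat_loops l g (Suc i)) = 1"
    using loops[of "i div l"] mod by (simp add: concat_loops_def path_def)
qed

sublocale subshift "sft A" d
proof
  show "x i < d" if "x \<in> sft A" for x i using that by (simp add: in_sft_iff)
  have "concat_loops k (\<lambda>_. connection 0 0) \<in> sft A"
    using k_pos two_states by (intro concat_loops_in_sft[of _ 0] path_connection) auto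
  then show "sft A \<noteq> {}" by blast
  show "shift x \<in> sft A" if "x \<in> sft A" for x using that by (rule shift_in_sft)
  show "x \<in> sft A" if *: "\<And>n. sft A \<inter> cylinder n x \<noteq> {}" for x
    unfolding in_sft_iff
  proof (intro allI)
    fix i
    obtain y where y: "y \<in> sft A" "y \<in> cylinder (Suc (Suc i)) x" using *[of "Suc (Suc i)"] by blast
    have "y i < d \<and> A $$ (y i, y (Suc i)) = 1" using iffD1[OF in_sft_iff y(1)] by (rule spec)
    moreover have "y i = x i" "y (Suc i) = x (Suc i)" using y(2) by (simp_all add: cylinder_def)
    ultimately show "x i < d \<and> A $$ (x i, x (Suc i)) = 1" by (simp only:)
  qed
qed

text \<open>Mixing in the form used for density: a connecting path leads from the end of a prefix of
  \<open>x\<close> to the start of \<open>y\<close>.\<close>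

lemma exists_connecting_point:
  assumes "x \<in> sft A" "y \<in> sft A"
  shows "\<exists>z\<in>sft A. z \<in> cylinder n x \<and> (shift ^^ (n + k)) z = y"
proof
  let ?c = "connection (x n) (y 0)"
  let ?z = "join n x (join k ?c y)"
  have c: "path k (x n) (y 0) ?c" using assms bounded by (intro path_connection)
  then have "join k ?c y 0 = x n" using k_pos by (simp add: join_def path_def)
  then show "?z \<in> sft A"
    using join_in_sft[OF c assms(2)] join_in_sft[OF path_of_sft[OF assms(1), of n]] by simp
  show "?z \<in> cylinder n x \<and> (shift ^^ (n + k)) ?z = y"
    by (auto simp: cylinder_def funpow_shift join_def)
qed

end

subsection \<open>Moran sets\<close>

lemma infsum_cmult_ennreal:
  fixes f :: "nat \<Rightarrow> ennreal"
  shows "(\<Sum>\<^sub>\<infinity>i\<in>J. c * f i) = c * (\<Sum>\<^sub>\<infinity>i\<in>J. f i)"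
proof -
  have eq: "(\<Sum>\<^sub>\<infinity>i\<in>J. g i) = (\<Sum>i. if i \<in> J then g i else 0)" for g :: "nat \<Rightarrow> ennreal"
    unfolding suminf_eq_infsum_ennreal by (rule infsum_cong_neutral) auto
  have "(\<Sum>\<^sub>\<infinity>i\<in>J. c * f i) = (\<Sum>i. c * (if i \<in> J then f i else 0))"
    unfolding eq by (rule suminf_cong) simp
  then show ?thesis unfolding eq by simp
qed

text \<open>The preimages of covering cylinders cover a space of mass 1, so the bounds on their
  measures sum to at least 1. Measurability enters through sets \<open>E\<close> enclosing the
  preimages, which for Moran sets are simple product sets.\<close>

lemma cylinder_mass_of_measure:
  assumes "prob_space M" "0 \<le> K"
    and E: "\<And>w n. \<exists>E\<in>sets M. {\<omega>\<in>space M. \<Phi> \<omega> \<in> cylinder n w} \<subseteq> E \<and>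
      emeasure M E \<le> ennreal (K * exp (- s * real n))"
    and "\<Phi> ` space M \<subseteq> Z"
  shows "cylinder_mass Z s"
proof -
  interpret prob_space M by fact
  \<comment> \<open>\<open>K + 1\<close> in place of \<open>K\<close> keeps the denominator positive
    when \<open>K\<close> is 0.\<close>
  define c where "c = 1 / (K + 1)"
  have c: "0 < c" using assms(2) by (simp add: c_def)
  show ?thesis
    unfolding cylinder_mass_def
  proof (intro exI[of _ c] conjI allI impI)
    fix J :: "nat set" and w n assume cov: "Z \<subseteq> (\<Union>i\<in>J. cylinder (n i) (w i))"
    have "\<forall>i. \<exists>E. E \<in> sets M \<and> {\<omega>\<in>space M. \<Phi> \<omega> \<in> cylinder (n i) (w i)} \<subseteq> E \<and>
        emeasure M E \<le> ennreal (K * exp (- s * real (n i)))"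
      using E by blast
    then obtain F where F: "\<And>i. F i \<in> sets M"
        "\<And>i. {\<omega>\<in>space M. \<Phi> \<omega> \<in> cylinder (n i) (w i)} \<subseteq> F i"
        "\<And>i. emeasure M (F i) \<le> ennreal (K * exp (- s * real (n i)))"
      unfolding choice_iff by blast
    have "space M \<subseteq> (\<Union>i\<in>J. F i)"
    proof
      fix \<omega> assume \<omega>: "\<omega> \<in> space M"
      then have "\<Phi> \<omega> \<in> Z" using assms(4) by blast
      then obtain i where "i \<in> J" "\<Phi> \<omega> \<in> cylinder (n i) (w i)" using cov by blast
      then show "\<omega> \<in> (\<Union>i\<in>J. F i)" using F(2)[of i] \<omega> by blast
    qed
    then have "1 \<le> emeasure M (\<Union>i\<in>J. F i)"
      using emeasure_mono[of "space M" "\<Union>i\<in>J. F i" M] F(1) emeasure_space_1 by auto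
    also have "\<dots> \<le> (\<Sum>\<^sub>\<infinity>i\<in>J. emeasure M (F i))"
      using F(1) by (intro emeasure_UN_le_infsum) auto
    also have "\<dots> \<le> (\<Sum>\<^sub>\<infinity>i\<in>J. ennreal (K + 1) * ennreal (exp (- s * real (n i))))"
    proof (rule infsum_ennreal_mono)
      fix i
      have "ennreal (K * exp (- s * real (n i))) \<le> ennreal ((K + 1) * exp (- s * real (n i)))"
        by (intro ennreal_leI) simp
      then show "emeasure M (F i) \<le> ennreal (K + 1) * ennreal (exp (- s * real (n i)))"
        using F(3)[of i] assms(2) by (simp add: ennreal_mult')
    qed
    finally have 1: "1 \<le> ennreal (K + 1) * (\<Sum>\<^sub>\<infinity>i\<in>J. ennreal (exp (- s * real (n i))))"
      by (simp only: infsum_cmult_ennreal)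
    have "ennreal c \<le> ennreal c * (ennreal (K + 1) * (\<Sum>\<^sub>\<infinity>i\<in>J. ennreal (exp (- s * real (n i)))))"
      using mult_left_mono[OF 1, of "ennreal c"] by simp
    also have "\<dots> = (ennreal c * ennreal (K + 1)) * (\<Sum>\<^sub>\<infinity>i\<in>J. ennreal (exp (- s * real (n i))))"
      by (simp only: mult.assoc)
    also have "ennreal c * ennreal (K + 1) = 1"
      unfolding c_def using assms(2) by (subst ennreal_mult[symmetric]) auto
    finally show "ennreal c \<le> (\<Sum>\<^sub>\<infinity>i\<in>J. ennreal (exp (- s * real (n i))))" by simp
  qed (fact c)
qed

text \<open>The choices \<omega> carry the product of uniform measures on \<open>W\<close>. A
  cylinder of length \<open>n\<close> fixes the choices in all complete blocks outside
  \<open>V\<close>; each contributes a factor \<open>1 / card W\<close>, and by \<open>freq\<close>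
  there are enough of them.\<close>

lemma Moran_cylinder_mass:
  fixes g :: "'a \<Rightarrow> nat \<Rightarrow> nat"
  assumes W: "finite W" "W \<noteq> {}" and l: "0 < l"
    and inj: "\<And>w w'. w \<in> W \<Longrightarrow> w' \<in> W \<Longrightarrow> \<forall>j<l. g w j = g w' j \<Longrightarrow> w = w'"
    and freq: "\<And>b. \<theta> * real b \<le> real (card ({..<b} - V))"
    and s: "s * real l \<le> \<theta> * ln (real (card W))"
    and Z: "\<And>\<omega>. (\<And>i. \<omega> i \<in> W) \<Longrightarrow> concat_loops l (\<lambda>i. if i \<in> V then z else g (\<omega> i)) \<in> Z"
  shows "cylinder_mass Z s"
proof (rule cylinder_mass_of_measure)
  define \<Phi> where "\<Phi> \<omega> = concat_loops l (\<lambda>i. if i \<in> V then z else g (\<omega> i))" for \<omega>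
  let ?U = "uniform_count_measure W"
  let ?M = "Pi\<^sub>M (UNIV :: nat set) (\<lambda>_. ?U)"
  interpret U: prob_space ?U using W by (rule prob_space_uniform_count_measure)
  interpret P: product_prob_space "\<lambda>_. ?U" "UNIV :: nat set" by unfold_locales
  show "prob_space ?M" by unfold_locales
  \<comment> \<open>Accounts for the incomplete last block, which is shorter than \<open>l\<close>;
    for negative \<open>s\<close> the bound holds with constant 1.\<close>
  define K where "K = exp (max s 0 * real l)"
  show "0 \<le> K" by (simp add: K_def)
  have space: "space ?M = {\<omega>. \<forall>i. \<omega> i \<in> W}"
    by (auto simp: space_PiM space_uniform_count_measure)
  show "\<Phi> ` space ?M \<subseteq> Z" using Z by (auto simp: space \<Phi>_def)
  have c: "real (card W) \<ge> 1" using W by (simp add: Suc_le_eq card_gt_0_iff)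
  show "\<exists>E\<in>sets ?M. {\<omega>\<in>space ?M. \<Phi> \<omega> \<in> cylinder n w} \<subseteq> E \<and>
      emeasure ?M E \<le> ennreal (K * exp (- s * real n))" for w n
  proof (cases "\<exists>\<omega>\<in>space ?M. \<Phi> \<omega> \<in> cylinder n w")
    case False
    then show ?thesis by (intro bexI[of _ "{}"]) auto
  next
    case True
    \<comment> \<open>One choice that reaches the cylinder; by injectivity all others agree with it
      on the free blocks \<open>J\<close>.\<close>
    then obtain \<omega>0 where \<omega>0: "\<omega>0 \<in> space ?M" "\<Phi> \<omega>0 \<in> cylinder n w" by blast
    define b where "b = n div l"
    define J where "J = {..<b} - V"
    define E where "E = prod_emb UNIV (\<lambda>_. ?U) J (Pi\<^sub>E J (\<lambda>i. {\<omega>0 i}))"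
    have J: "finite J" by (simp add: J_def)
    have sing: "{\<omega>0 i} \<in> sets ?U" for i
      using \<omega>0(1) by (simp add: space sets_uniform_count_measure)
    have "E \<in> sets ?M"
      unfolding E_def using J sing by (intro sets_PiM_I) auto
    moreover have "{\<omega>\<in>space ?M. \<Phi> \<omega> \<in> cylinder n w} \<subseteq> E"
    proof
      fix \<omega> assume \<omega>: "\<omega> \<in> {\<omega>\<in>space ?M. \<Phi> \<omega> \<in> cylinder n w}"
      have "\<omega> i = \<omega>0 i" if i: "i \<in> J" for i
      proof (rule inj)
        show "\<omega> i \<in> W" "\<omega>0 i \<in> W" using \<omega> \<omega>0(1) by (simp_all add: space)
        show "\<forall>j<l. g (\<omega> i) j = g (\<omega>0 i) j"
        proof (intro allI impI)
          fix j assume j: "j < l"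
          have "Suc i * l \<le> b * l" using i by (intro mult_le_mono1) (auto simp: J_def)
          moreover have "b * l \<le> n" by (simp add: b_def)
          moreover have "i * l + j < Suc i * l" using j by simp
          ultimately have "i * l + j < n" by linarith
          then have "\<Phi> \<omega> (i * l + j) = \<Phi> \<omega>0 (i * l + j)"
            using \<omega> \<omega>0(2) by (simp add: cylinder_def)
          then show "g (\<omega> i) j = g (\<omega>0 i) j"
            using i j by (simp add: \<Phi>_def concat_loops_block J_def)
        qed
      qed
      moreover have "\<omega> \<in> space ?M" using \<omega> by simp
      ultimately show "\<omega> \<in> E"
        unfolding E_def by (auto simp: prod_emb_def space_PiM restrict_def PiE_iff extensional_def)
    qed
    moreover have "emeasure ?M E \<le> ennreal (K * exp (- s * real n))"
    proof -
      have "emeasure ?M E = (\<Prod>i\<in>J. emeasure ?U {\<omega>0 i})"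
        unfolding E_def using J sing by (intro P.emeasure_PiM_emb) auto
      also have "\<dots> = (\<Prod>i\<in>J. ennreal (1 / real (card W)))"
        using \<omega>0(1) W by (intro prod.cong refl) (simp add: space emeasure_uniform_count_measure)
      also have "\<dots> = ennreal ((1 / real (card W)) ^ card J)"
        by (simp add: ennreal_power)
      also have "\<dots> \<le> ennreal (K * exp (- s * real n))"
      proof (rule ennreal_leI)
        have "s * real n \<le> max s 0 * real l + ln (real (card W)) * real (card J)"
        proof (cases "s \<ge> 0")
          case True
          have "n \<le> l * (b + 1)" unfolding b_def
            using dividend_less_div_times[of l n] l by (simp add: algebra_simps)
          then have "real n \<le> real l * (real b + 1)"
            by (metis of_nat_1 of_nat_add of_nat_le_iff of_nat_mult)
          then have "s * real n \<le> s * (real l * (real b + 1))" using True by (rule mult_left_mono)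
          also have "\<dots> = s * real l * real b + s * real l" by (simp add: algebra_simps)
          also have "s * real l * real b \<le> \<theta> * ln (real (card W)) * real b"
            using s by (rule mult_right_mono) simp
          also have "\<theta> * ln (real (card W)) * real b = ln (real (card W)) * (\<theta> * real b)" by simp
          also have "\<dots> \<le> ln (real (card W)) * real (card J)"
            using freq[of b] c by (intro mult_left_mono) (auto simp: J_def)
          finally show ?thesis using True by simp
        next
          case False
          then have "s * real n \<le> 0" by (simp add: mult_nonpos_nonneg)
          also have "0 \<le> ln (real (card W)) * real (card J)" using c by simp
          finally show ?thesis using False by simp
        qed
        then have "exp (- (ln (real (card W)) * real (card J))) \<le> exp (max s 0 * real l + - s * real n)"
          by simp
        also have "\<dots> = K * exp (- s * real n)" by (simp add: K_def exp_add[symmetric])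
        also have "exp (- (ln (real (card W)) * real (card J))) = (1 / real (card W)) ^ card J"
        proof -
          have "exp (- (ln (real (card W)) * real (card J))) = exp (- ln (real (card W))) ^ card J"
            by (subst exp_of_nat2_mult[symmetric]) simp
          then show ?thesis using c by (simp add: exp_minus inverse_eq_divide)
        qed
        finally show "(1 / real (card W)) ^ card J \<le> K * exp (- s * real n)" .
      qed
      finally show ?thesis .
    qed
    ultimately show ?thesis by blast
  qed
qed

subsection \<open>Gaps in sets of natural numbers\<close>

text \<open>Relative density at least \<open>1 / Suc m\<close> for infinitely many \<open>n\<close>.
  The countable range of \<open>m\<close> makes the condition visibly Borel.\<close>

definition pos_upper_density :: "nat set \<Rightarrow> bool" where
  "pos_upper_density D \<longleftrightarrow> (\<exists>m. \<exists>\<^sub>\<infinity>n. n \<le> Suc m * card (D \<inter> {..<n}))"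

text \<open>Gaps are measured relative to their left end, because only gaps proportional to it
  influence averages.\<close>

definition long_gaps :: "real \<Rightarrow> nat set \<Rightarrow> bool" where
  "long_gaps r D \<longleftrightarrow> (\<exists>\<^sub>\<infinity>n. \<forall>i. n \<le> i \<and> real i \<le> (1 + r) * real n \<longrightarrow> i \<notin> D)"

text \<open>The supremum of the exponents \<open>r\<close> of long gaps is \<open>\<rho>\<close>. Only rational exponents are
  used, which keeps the condition Borel.\<close>

definition gap_ratio :: "real \<Rightarrow> nat set \<Rightarrow> bool" where
  "gap_ratio \<rho> D \<longleftrightarrow>
     (\<forall>r\<in>\<rat>. 0 < r \<longrightarrow> (r < \<rho> \<longrightarrow> long_gaps r D) \<and> (\<rho> < r \<longrightarrow> \<not> long_gaps r D))"

lemma gap_ratio_unique: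
  assumes "gap_ratio \<rho> D" "gap_ratio \<rho>' D" "0 < \<rho>" "0 < \<rho>'"
  shows "\<rho> = \<rho>'"
proof -
  have False if "gap_ratio \<rho> D" "gap_ratio \<rho>' D" "0 < \<rho>" "\<rho> < \<rho>'" for \<rho> \<rho>' :: real
  proof -
    obtain r where "r \<in> \<rat>" "\<rho> < r" "r < \<rho>'" using Rats_dense_in_real[OF \<open>\<rho> < \<rho>'\<close>] by blast
    then show False using that unfolding gap_ratio_def by (meson less_trans)
  qed
  then show ?thesis using assms by (meson linorder_neqE_linordered_idom)
qed

lemma INFM_nat_Suc: "(\<exists>\<^sub>\<infinity>n. P (Suc n)) \<longleftrightarrow> (\<exists>\<^sub>\<infinity>n. P n)"
  unfolding cofinite_eq_sequentially frequently_def
  using eventually_sequentially_Suc[of "\<lambda>n. \<not> P n"] by simp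

text \<open>Moving a gap that starts at \<open>Suc n\<close> down by one leaves
  \<open>[n, (1 + r) * n + r]\<close>, so nothing is lost.\<close>

lemma long_gaps_Suc:
  assumes "long_gaps r D" "0 \<le> r" shows "long_gaps r {i. Suc i \<in> D}"
  unfolding long_gaps_def
proof (rule INFM_mono)
  show "\<exists>\<^sub>\<infinity>n. \<forall>i. Suc n \<le> i \<and> real i \<le> (1 + r) * real (Suc n) \<longrightarrow> i \<notin> D"
    using assms(1) unfolding long_gaps_def
    by (rule INFM_nat_Suc[of "\<lambda>n. \<forall>i. n \<le> i \<and> real i \<le> (1 + r) * real n \<longrightarrow> i \<notin> D", THEN iffD2])
  fix n assume *: "\<forall>i. Suc n \<le> i \<and> real i \<le> (1 + r) * real (Suc n) \<longrightarrow> i \<notin> D"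
  show "\<forall>i. n \<le> i \<and> real i \<le> (1 + r) * real n \<longrightarrow> i \<notin> {i. Suc i \<in> D}"
  proof (intro allI impI)
    fix i assume "n \<le> i \<and> real i \<le> (1 + r) * real n"
    then have "Suc n \<le> Suc i \<and> real (Suc i) \<le> (1 + r) * real (Suc n)"
      using assms(2) by (simp add: algebra_simps)
    then show "i \<notin> {i. Suc i \<in> D}" using * by blast
  qed
qed

text \<open>Moving a gap up by one loses a bounded amount at its right end, which the difference
  \<open>r - r'\<close> absorbs for large \<open>n\<close>.\<close>

lemma long_gaps_of_Suc:
  assumes "long_gaps r {i. Suc i \<in> D}" "0 \<le> r'" "r' < r" shows "long_gaps r' D"
proof -
  obtain m :: nat where m: "r' / (r - r') \<le> real m" using real_arch_simple by blast
  have "\<exists>\<^sub>\<infinity>n. \<forall>i. Suc n \<le> i \<and> real i \<le> (1 + r') * real (Suc n) \<longrightarrow> i \<notin> D"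
  proof (rule INFM_mono)
    show "\<exists>\<^sub>\<infinity>n. (\<forall>i. n \<le> i \<and> real i \<le> (1 + r) * real n \<longrightarrow> i \<notin> {i. Suc i \<in> D}) \<and> m \<le> n"
      using assms(1) unfolding long_gaps_def by (rule INFM_conjI) (auto simp: MOST_ge_nat)
    fix n assume *: "(\<forall>i. n \<le> i \<and> real i \<le> (1 + r) * real n \<longrightarrow> i \<notin> {i. Suc i \<in> D}) \<and> m \<le> n"
    have "r' / (r - r') \<le> real n" using m * by linarith
    then have n: "r' \<le> (r - r') * real n" using assms(3) by (simp add: divide_le_eq mult.commute)
    show "\<forall>i. Suc n \<le> i \<and> real i \<le> (1 + r') * real (Suc n) \<longrightarrow> i \<notin> D"
    proof (intro allI impI)
      fix i assume i: "Suc n \<le> i \<and> real i \<le> (1 + r') * real (Suc n)"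
      then obtain i' where i': "i = Suc i'" by (cases i) auto
      have "real i' \<le> (1 + r) * real n" using i n unfolding i' by (simp add: algebra_simps)
      then show "i \<notin> D" using * i unfolding i' by simp
    qed
  qed
  then show ?thesis unfolding long_gaps_def
    by (rule INFM_nat_Suc[of "\<lambda>n. \<forall>i. n \<le> i \<and> real i \<le> (1 + r') * real n \<longrightarrow> i \<notin> D", THEN iffD1])
qed

text \<open>The loss in \<open>long_gaps_of_Suc\<close> is harmless, as another rational fits
  between \<open>r\<close> and \<rho>.\<close>

lemma gap_ratio_Suc_iff:
  assumes "0 < \<rho>" shows "gap_ratio \<rho> {i. Suc i \<in> D} \<longleftrightarrow> gap_ratio \<rho> D"
proof
  assume L: "gap_ratio \<rho> {i. Suc i \<in> D}"
  show "gap_ratio \<rho> D"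
    unfolding gap_ratio_def
  proof (intro ballI impI conjI)
    fix r :: real assume r: "r \<in> \<rat>" "0 < r" "r < \<rho>"
    obtain r' where "r' \<in> \<rat>" "r < r'" "r' < \<rho>" using Rats_dense_in_real[OF r(3)] by blast
    then show "long_gaps r D"
      using L r unfolding gap_ratio_def by (intro long_gaps_of_Suc[of r' D r]) auto
  next
    fix r :: real assume r: "r \<in> \<rat>" "0 < r" "\<rho> < r"
    then show "\<not> long_gaps r D"
      using L long_gaps_Suc[of r D] unfolding gap_ratio_def by auto
  qed
next
  assume R: "gap_ratio \<rho> D"
  show "gap_ratio \<rho> {i. Suc i \<in> D}"
    unfolding gap_ratio_def
  proof (intro ballI impI conjI)
    fix r :: real assume r: "r \<in> \<rat>" "0 < r" "r < \<rho>"
    then show "long_gaps r {i. Suc i \<in> D}"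
      using R unfolding gap_ratio_def by (intro long_gaps_Suc) auto
  next
    fix r :: real assume r: "r \<in> \<rat>" "0 < r" "\<rho> < r"
    obtain r' where r': "r' \<in> \<rat>" "\<rho> < r'" "r' < r" using Rats_dense_in_real[OF r(3)] by blast
    then have "\<not> long_gaps r' D" using R assms unfolding gap_ratio_def by auto
    then show "\<not> long_gaps r {i. Suc i \<in> D}"
      using long_gaps_of_Suc[of r D r'] r' assms by auto
  qed
qed

lemma card_Int_lessThan_Suc:
  "card (D \<inter> {..<Suc n}) = card ({i. Suc i \<in> D} \<inter> {..<n}) + (if 0 \<in> D then 1 else 0)"
proof -
  have "D \<inter> {..<Suc n} = Suc ` ({i. Suc i \<in> D} \<inter> {..<n}) \<union> (if 0 \<in> D then {0} else {})"
    by (auto simp: image_iff less_Suc_eq_0_disj split: if_splits)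
  also have "card \<dots> = card (Suc ` ({i. Suc i \<in> D} \<inter> {..<n})) + card (if 0 \<in> D then {0::nat} else {})"
    by (rule card_Un_disjoint) auto
  finally show ?thesis by (simp add: card_image)
qed

text \<open>Shifting changes each count by at most 1, which a larger constant \<open>m\<close>
  absorbs once the count is positive.\<close>

lemma pos_upper_density_Suc_iff: "pos_upper_density {i. Suc i \<in> D} \<longleftrightarrow> pos_upper_density D"
proof
  assume "pos_upper_density {i. Suc i \<in> D}"
  then obtain m where "\<exists>\<^sub>\<infinity>n. n \<le> Suc m * card ({i. Suc i \<in> D} \<inter> {..<n})"
    unfolding pos_upper_density_def by blast
  then have *: "\<exists>\<^sub>\<infinity>n. n \<le> Suc m * card ({i. Suc i \<in> D} \<inter> {..<n}) \<and> 1 \<le> n"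
    by (rule INFM_conjI) (auto simp: MOST_ge_nat)
  have "\<exists>\<^sub>\<infinity>n. Suc n \<le> Suc (Suc m) * card (D \<inter> {..<Suc n})"
  proof (rule INFM_mono[OF *])
    fix n assume n: "n \<le> Suc m * card ({i. Suc i \<in> D} \<inter> {..<n}) \<and> 1 \<le> n"
    let ?c = "card ({i. Suc i \<in> D} \<inter> {..<n})"
    have "?c \<noteq> 0" using n by (metis mult_0_right not_one_le_zero le_trans)
    then have "1 \<le> ?c" by linarith
    moreover have "Suc (Suc m) * ?c = Suc m * ?c + ?c" by simp
    ultimately have "Suc n \<le> Suc (Suc m) * ?c" using n by linarith
    also have "\<dots> \<le> Suc (Suc m) * card (D \<inter> {..<Suc n})"
      by (rule mult_le_mono2) (simp add: card_Int_lessThan_Suc)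
    finally show "Suc n \<le> Suc (Suc m) * card (D \<inter> {..<Suc n})" .
  qed
  then have "\<exists>\<^sub>\<infinity>n. n \<le> Suc (Suc m) * card (D \<inter> {..<n})"
    by (rule INFM_nat_Suc[of "\<lambda>n. n \<le> Suc (Suc m) * card (D \<inter> {..<n})", THEN iffD1])
  then show "pos_upper_density D" unfolding pos_upper_density_def by blast
next
  assume "pos_upper_density D"
  then obtain m where "\<exists>\<^sub>\<infinity>n. n \<le> Suc m * card (D \<inter> {..<n})"
    unfolding pos_upper_density_def by blast
  then have "\<exists>\<^sub>\<infinity>n. Suc n \<le> Suc m * card (D \<inter> {..<Suc n})"
    unfolding INFM_nat_Suc[of "\<lambda>n. n \<le> Suc m * card (D \<inter> {..<n})"] .
  then have *: "\<exists>\<^sub>\<infinity>n. Suc n \<le> Suc m * card (D \<inter> {..<Suc n}) \<and> Suc m \<le> n"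
    by (rule INFM_conjI) (auto simp: MOST_ge_nat)
  \<comment> \<open>The bound \<open>Suc m \<le> n\<close> forces a positive count, so the extra
    \<open>Suc m\<close> at most doubles the right-hand side.\<close>
  have "\<exists>\<^sub>\<infinity>n. n \<le> Suc (2 * m + 1) * card ({i. Suc i \<in> D} \<inter> {..<n})"
  proof (rule INFM_mono[OF *])
    fix n assume n: "Suc n \<le> Suc m * card (D \<inter> {..<Suc n}) \<and> Suc m \<le> n"
    let ?c = "card ({i. Suc i \<in> D} \<inter> {..<n})"
    have "card (D \<inter> {..<Suc n}) \<le> ?c + 1" by (simp add: card_Int_lessThan_Suc)
    then have "Suc m * card (D \<inter> {..<Suc n}) \<le> Suc m * (?c + 1)" by (rule mult_le_mono2)
    then have le: "Suc n \<le> Suc m * ?c + Suc m" using n by simp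
    then have "Suc m * ?c \<noteq> 0" using n by linarith
    then have "?c \<noteq> 0" by (metis mult_0_right)
    then have "1 \<le> ?c" by linarith
    then have "Suc m * 1 \<le> Suc m * ?c" by (rule mult_le_mono2)
    then have "n \<le> 2 * (Suc m * ?c)" using le unfolding mult_1_right by linarith
    then show "n \<le> Suc (2 * m + 1) * ?c" by (simp add: algebra_simps)
  qed
  then show "pos_upper_density {i. Suc i \<in> D}" unfolding pos_upper_density_def by blast
qed

text \<open>Across a long gap the relative density drops by the factor \<open>1 + r\<close>.\<close>

lemma density_not_convergent:
  assumes "pos_upper_density D" "long_gaps r D" "0 < r"
  shows "\<not> convergent (\<lambda>n. real (card (D \<inter> {..<n})) / real n)"
proof
  assume "convergent (\<lambda>n. real (card (D \<inter> {..<n})) / real n)"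
  then obtain L where L: "(\<lambda>n. real (card (D \<inter> {..<n})) / real n) \<longlonglongrightarrow> L"
    unfolding convergent_def by blast
  let ?S = "\<lambda>n. real (card (D \<inter> {..<n}))"
  have ev: "\<exists>N. \<forall>n\<ge>N. \<bar>?S n / real n - L\<bar> < \<epsilon>" if "0 < \<epsilon>" for \<epsilon>
    using LIMSEQ_D[OF L that] by simp
  obtain m where m: "\<exists>\<^sub>\<infinity>n. n \<le> Suc m * card (D \<inter> {..<n})"
    using assms(1) unfolding pos_upper_density_def by blast
  have "0 < L"
  proof (rule ccontr)
    assume "\<not> 0 < L"
    obtain N where N: "\<And>n. n \<ge> N \<Longrightarrow> \<bar>?S n / real n - L\<bar> < 1 / real (Suc m)"
      using ev[of "1 / real (Suc m)"] by auto
    obtain n where n: "n \<ge> Suc N" "n \<le> Suc m * card (D \<inter> {..<n})"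
      using m unfolding INFM_nat_le by blast
    have "real n \<le> real (Suc m) * ?S n" using n(2) by (metis of_nat_le_iff of_nat_mult)
    then have "1 / real (Suc m) \<le> ?S n / real n"
      using n(1) by (simp add: field_simps)
    moreover have "\<bar>?S n / real n - L\<bar> < 1 / real (Suc m)" using N n(1) by simp
    ultimately show False using \<open>\<not> 0 < L\<close> by linarith
  qed
  \<comment> \<open>Small enough that \<open>(L - \<epsilon>) * (1 + r)\<close> exceeds
    \<open>L + \<epsilon>\<close>.\<close>
  define \<epsilon> where "\<epsilon> = r * L / (2 + r) / 2"
  have \<epsilon>: "0 < \<epsilon>" using assms(3) \<open>0 < L\<close> by (simp add: \<epsilon>_def)
  have "(2 + r) * \<epsilon> = r * L / 2" using assms(3) by (simp add: \<epsilon>_def field_simps)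
  moreover have "0 < r * L" using assms(3) \<open>0 < L\<close> by simp
  ultimately have small: "(2 + r) * \<epsilon> < r * L" by linarith
  obtain N where N: "\<And>n. n \<ge> N \<Longrightarrow> \<bar>?S n / real n - L\<bar> < \<epsilon>" using ev[OF \<epsilon>] by blast
  obtain n where n: "n \<ge> Suc N" "\<forall>i. n \<le> i \<and> real i \<le> (1 + r) * real n \<longrightarrow> i \<notin> D"
    using assms(2) unfolding long_gaps_def INFM_nat_le by blast
  \<comment> \<open>The first index past the gap: the count is the same as at \<open>n\<close>, the
    denominator larger by at least the factor \<open>1 + r\<close>.\<close>
  define n' where "n' = Suc (nat \<lfloor>(1 + r) * real n\<rfloor>)"
  have n'_gt: "(1 + r) * real n \<le> real n'" unfolding n'_def using assms(3) by linarith
  have "real n \<le> (1 + r) * real n" using assms(3) by (simp add: algebra_simps)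
  then have "n \<le> n'" using n'_gt by linarith
  have "i < n" if "i \<in> D" "i < n'" for i
  proof (rule ccontr)
    assume "\<not> i < n"
    moreover have "real i \<le> (1 + r) * real n"
    proof -
      have "int i \<le> \<lfloor>(1 + r) * real n\<rfloor>" using that(2) assms(3) unfolding n'_def by (simp add: le_nat_iff less_Suc_eq_le)
      then show ?thesis by (simp add: le_floor_iff)
    qed
    ultimately show False using n(2) that(1) by auto
  qed
  then have "D \<inter> {..<n'} = D \<inter> {..<n}" using \<open>n \<le> n'\<close> by auto
  then have S: "?S n' = ?S n" by simp
  have npos: "0 < real n" using n(1) by simp
  have n'pos: "0 < real n'" using npos \<open>n \<le> n'\<close> by linarith
  have "?S n / real n < L + \<epsilon>" using N[of n] n(1) by (simp add: abs_less_iff)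
  then have up: "?S n < (L + \<epsilon>) * real n" using npos by (simp add: divide_less_eq)
  have "L - \<epsilon> < ?S n' / real n'" using N[of n'] n(1) \<open>n \<le> n'\<close> by (simp add: abs_less_iff)
  then have lo: "(L - \<epsilon>) * real n' < ?S n" using n'pos S by (simp add: less_divide_eq)
  have pos: "0 \<le> L - \<epsilon>"
  proof -
    have "r * \<epsilon> + 2 * \<epsilon> < r * L" using small by (simp add: algebra_simps)
    then have "r * \<epsilon> < r * L" using \<epsilon> by linarith
    then show ?thesis using assms(3) by simp
  qed
  have "(L - \<epsilon>) * ((1 + r) * real n) \<le> (L - \<epsilon>) * real n'" using n'_gt pos by (rule mult_left_mono)
  then have "(L - \<epsilon>) * (1 + r) * real n < (L + \<epsilon>) * real n" using lo up by (simp add: mult.assoc)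
  then have "(L - \<epsilon>) * (1 + r) < L + \<epsilon>" using npos by simp
  then show False using small by (simp add: algebra_simps)
qed

subsection \<open>Windows\<close>

text \<open>For \<rho> < 1 window \<open>j\<close> ends before \<open>2 * 4 ^ j\<close>, so the
  indices from there up to \<open>4 ^ Suc j\<close> are always free.\<close>

definition windows :: "real \<Rightarrow> nat set" where
  "windows \<rho> = {i. \<exists>j. 4 ^ j < i \<and> real i \<le> (1 + \<rho>) * 4 ^ j}"

lemma not_in_windowsI:
  assumes "0 < \<rho>" "\<rho> < 1" "(1 + \<rho>) * 4 ^ j < real i" "i \<le> 4 ^ Suc j"
  shows "i \<notin> windows \<rho>"
proof
  assume "i \<in> windows \<rho>"
  then obtain j' where j': "4 ^ j' < i" "real i \<le> (1 + \<rho>) * 4 ^ j'"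
    unfolding windows_def by blast
  have "(4::nat) ^ j' < 4 ^ Suc j" using j'(1) assms(4) by linarith
  then have "j' < Suc j" by (rule power_less_imp_less_exp[rotated]) simp
  then have "(4::real) ^ j' \<le> 4 ^ j" by (intro power_increasing) auto
  then have "(1 + \<rho>) * 4 ^ j' \<le> (1 + \<rho>) * 4 ^ j" using assms(1) by (intro mult_left_mono) auto
  then show False using j'(2) assms(3) by linarith
qed

text \<open>If \<open>i0\<close> lies in a window, the first index past that window is free, and the
  window ends within the factor \<open>1 + \<rho>\<close> of \<open>i0\<close>. The summand 1 is
  rounding.\<close>

lemma exists_not_in_windows:
  assumes "0 < \<rho>" "\<rho> < 1"
  shows "\<exists>i\<ge>i0. real i \<le> (1 + \<rho>) * real i0 + 1 \<and> i \<notin> windows \<rho>"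
proof (cases "i0 \<in> windows \<rho>")
  case False
  then show ?thesis using assms by (intro exI[of _ i0]) (simp add: algebra_simps)
next
  case True
  then obtain j where j: "4 ^ j < i0" "real i0 \<le> (1 + \<rho>) * 4 ^ j"
    unfolding windows_def by blast
  define i where "i = Suc (nat \<lfloor>(1 + \<rho>) * 4 ^ j\<rfloor>)"
  have "0 \<le> (1 + \<rho>) * 4 ^ j" using assms by simp
  then have i: "(1 + \<rho>) * 4 ^ j < real i" "real i \<le> (1 + \<rho>) * 4 ^ j + 1"
    unfolding i_def by linarith+
  have "real (4 ^ j) < real i0" using j(1) by (simp only: of_nat_less_iff)
  then have "(1 + \<rho>) * 4 ^ j \<le> (1 + \<rho>) * real i0" using assms by (intro mult_left_mono) auto
  moreover have "i0 \<le> i" using j(2) i(1) by linarith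
  moreover have "i \<le> 4 ^ Suc j"
  proof -
    have "(1 + \<rho>) * 4 ^ j \<le> 2 * 4 ^ j" using assms by (intro mult_right_mono) auto
    then have "real i \<le> 2 * 4 ^ j + 1" using i(2) by linarith
    also have "\<dots> \<le> 4 * (4::real) ^ j"
      using one_le_power[of "4::real" j] by linarith
    finally have "real i \<le> real (4 ^ Suc j)" by simp
    then show ?thesis by (simp only: of_nat_le_iff)
  qed
  ultimately show ?thesis using not_in_windowsI[OF assms i(1)] i(2) by (intro exI[of _ i]) auto
qed

lemma sum_power_4_le: "(\<Sum>j<n. (4::real) ^ j) \<le> 4 ^ n / 3"
  by (induction n) auto

text \<open>With \<open>n\<close> minimal such that \<open>b \<le> 4 ^ n\<close>, only windows below
  \<open>n\<close> meet \<open>{..<b}\<close>. Their sizes form a geometric series bounded by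
  \<open>\<rho> * 4 ^ n / 3\<close>, while \<open>4 ^ n < 4 * b\<close> unless \<open>n\<close> is
  0.\<close>

lemma card_windows_le:
  assumes "0 < \<rho>"
  shows "real (card ({..<b} \<inter> windows \<rho>)) \<le> 2 * \<rho> * real b"
proof -
  define n where "n = (LEAST n. b \<le> 4 ^ n)"
  have "b \<le> 4 ^ b" by (rule less_imp_le, rule power_gt_expt) simp
  then have n: "b \<le> 4 ^ n" unfolding n_def by (rule LeastI)
  have n_le: "4 ^ m < b" if "m < n" for m
    using not_less_Least[of m "\<lambda>n. b \<le> 4 ^ n"] that unfolding n_def by simp
  define I where "I j = {i. 4 ^ j < i \<and> real i \<le> (1 + \<rho>) * 4 ^ j}" for j :: nat
  have I: "finite (I j) \<and> real (card (I j)) \<le> \<rho> * 4 ^ j" for j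
  proof -
    have "0 \<le> \<rho> * 4 ^ j" using assms by simp
    have "I j \<subseteq> {4 ^ j <.. 4 ^ j + nat \<lfloor>\<rho> * 4 ^ j\<rfloor>}"
    proof
      fix i assume "i \<in> I j"
      then have i: "4 ^ j < i" "real i \<le> (1 + \<rho>) * 4 ^ j" by (auto simp: I_def)
      then have "real_of_int (int i - 4 ^ j) \<le> \<rho> * 4 ^ j" by (simp add: algebra_simps)
      then have "int i - 4 ^ j \<le> \<lfloor>\<rho> * 4 ^ j\<rfloor>" by (simp only: le_floor_iff)
      then have "int i \<le> int (4 ^ j + nat \<lfloor>\<rho> * 4 ^ j\<rfloor>)" using \<open>0 \<le> \<rho> * 4 ^ j\<close> by simp
      then show "i \<in> {4 ^ j <.. 4 ^ j + nat \<lfloor>\<rho> * 4 ^ j\<rfloor>}" using i(1) by (simp only: of_nat_le_iff) simp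
    qed
    then have "finite (I j)" "card (I j) \<le> nat \<lfloor>\<rho> * 4 ^ j\<rfloor>"
      using finite_subset card_mono[of "{4 ^ j <.. 4 ^ j + nat \<lfloor>\<rho> * 4 ^ j\<rfloor>}" "I j"] by auto
    moreover have "real (nat \<lfloor>\<rho> * 4 ^ j\<rfloor>) \<le> \<rho> * 4 ^ j" using \<open>0 \<le> \<rho> * 4 ^ j\<close> by simp
    ultimately show ?thesis by linarith
  qed
  have "{..<b} \<inter> windows \<rho> \<subseteq> (\<Union>j<n. I j)"
  proof
    fix i assume i: "i \<in> {..<b} \<inter> windows \<rho>"
    then obtain j where j: "4 ^ j < i" "real i \<le> (1 + \<rho>) * 4 ^ j" unfolding windows_def by blast
    have "(4::nat) ^ j < 4 ^ n" using j(1) i n by (simp add: order.strict_trans2)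
    then have "j < n" by (rule power_less_imp_less_exp[rotated]) simp
    then show "i \<in> (\<Union>j<n. I j)" using j by (auto simp: I_def)
  qed
  then have "card ({..<b} \<inter> windows \<rho>) \<le> card (\<Union>j<n. I j)" using I by (intro card_mono) auto
  also have "\<dots> \<le> (\<Sum>j<n. card (I j))" by (intro card_UN_le) simp
  finally have "real (card ({..<b} \<inter> windows \<rho>)) \<le> (\<Sum>j<n. real (card (I j)))"
    by (metis of_nat_le_iff of_nat_sum)
  also have "\<dots> \<le> (\<Sum>j<n. \<rho> * 4 ^ j)" using I by (intro sum_mono) blast
  also have "\<dots> = \<rho> * (\<Sum>j<n. 4 ^ j)" by (simp add: sum_distrib_left)
  also have "\<dots> \<le> \<rho> * (2 * real b)"
  proof (rule mult_left_mono)
    show "(\<Sum>j<n. (4::real) ^ j) \<le> 2 * real b"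
    proof (cases n)
      case (Suc m)
      have "4 ^ m < b" using n_le[of m] Suc by simp
      then have "real (4 ^ m) < real b" by (simp only: of_nat_less_iff)
      moreover have "(4::real) ^ n = 4 * real (4 ^ m)" using Suc by simp
      ultimately show ?thesis using sum_power_4_le[of n] by linarith
    qed simp
  qed (use assms in simp)
  finally show ?thesis by simp
qed

lemma card_diff_windows_ge:
  assumes "0 < \<rho>"
  shows "(1 - 2 * \<rho>) * real b \<le> real (card ({..<b} - windows \<rho>))"
proof -
  have "card {..<b} = card ({..<b} \<inter> windows \<rho>) + card ({..<b} - windows \<rho>)"
    by (rule card_Int_Diff) simp
  then have "real b = real (card ({..<b} \<inter> windows \<rho>)) + real (card ({..<b} - windows \<rho>))"
    by simp
  then show ?thesis using card_windows_le[OF assms, of b] by (simp add: algebra_simps)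
qed

text \<open>Abstracts the defect set of a Moran point with blocks of length \<open>l\<close>:
  \<open>p\<close> is the place of a defect in every free block. A defect at \<open>i\<close>
  compares \<open>i\<close> with \<open>i + q\<close>, so it is excluded when both lie in window
  blocks.\<close>

locale window_gaps =
  fixes \<rho> :: real and l p q :: nat and D :: "nat set"
  assumes \<rho>: "0 < \<rho>" "\<rho> < 1"
    and p: "p < l" and q: "q \<le> l"
    and outside: "\<And>i. i \<notin> windows \<rho> \<Longrightarrow> i * l + p \<in> D"
    and inside: "\<And>i. i div l \<in> windows \<rho> \<Longrightarrow> (i + q) div l \<in> windows \<rho> \<Longrightarrow> i \<notin> D"
begin

lemma l_pos: "0 < l" using p by simp

text \<open>The \<open>2 * 4 ^ m\<close> blocks after \<open>2 * 4 ^ m\<close> are free and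
  contribute a defect each, among at most \<open>5 * l * 4 ^ m\<close> positions.\<close>

lemma pos_upper_density: "pos_upper_density D"
  unfolding pos_upper_density_def INFM_nat_le
proof (rule exI[of _ "4 * l"], rule allI)
  fix m :: nat
  define n where "n = (4 * 4 ^ m + 1) * l"
  let ?I = "{2 * 4 ^ m <.. 4 * 4 ^ m} :: nat set"
  have "m < 4 ^ m" by (rule power_gt_expt) simp
  also have "4 ^ m * 1 \<le> n" unfolding n_def using l_pos by (intro mult_le_mono) auto
  finally have "m \<le> n" by simp
  have sub: "(\<lambda>i. i * l + p) ` ?I \<subseteq> D \<inter> {..<n}"
  proof (intro subsetI, elim imageE)
    fix x i assume x: "x = i * l + p" and i: "i \<in> ?I"
    have "2 * 4 ^ m < real i" using i by (simp add: of_nat_less_iff[where ?'a = real, symmetric] del: of_nat_less_iff)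
    moreover have "(1 + \<rho>) * 4 ^ m \<le> 2 * 4 ^ m" using \<rho> by (intro mult_right_mono) auto
    ultimately have "(1 + \<rho>) * 4 ^ m < real i" by linarith
    then have "i \<notin> windows \<rho>" using \<rho> i by (intro not_in_windowsI[of \<rho> m]) auto
    then have "x \<in> D" using outside x by blast
    moreover have "i * l \<le> 4 * 4 ^ m * l" using i by (intro mult_le_mono1) simp
    then have "x < 4 * 4 ^ m * l + l" using p unfolding x by linarith
    then have "x < n" by (simp add: n_def algebra_simps)
    ultimately show "x \<in> D \<inter> {..<n}" by simp
  qed
  have "inj_on (\<lambda>i. i * l + p) ?I" using l_pos by (auto simp: inj_on_def)
  then have "card ?I = card ((\<lambda>i. i * l + p) ` ?I)" by (simp add: card_image)
  also have "\<dots> \<le> card (D \<inter> {..<n})" using sub by (intro card_mono) auto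
  finally have "2 * 4 ^ m \<le> card (D \<inter> {..<n})" by simp
  then have "Suc (4 * l) * (2 * 4 ^ m) \<le> Suc (4 * l) * card (D \<inter> {..<n})" by (rule mult_le_mono2)
  moreover have "n \<le> Suc (4 * l) * (2 * 4 ^ m)"
  proof -
    have "1 * l \<le> 4 ^ m * l" by (intro mult_le_mono1) simp
    moreover have "n = 4 * (4 ^ m * l) + l" by (simp add: n_def algebra_simps)
    moreover have "Suc (4 * l) * (2 * 4 ^ m) = 8 * (4 ^ m * l) + 2 * 4 ^ m" by (simp add: algebra_simps)
    ultimately show ?thesis by linarith
  qed
  ultimately have "n \<le> Suc (4 * l) * card (D \<inter> {..<n})" by linarith
  then show "\<exists>n\<ge>m. n \<le> Suc (4 * l) * card (D \<inter> {..<n})" using \<open>m \<le> n\<close> by blast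
qed

lemma long_gaps_of_less:
  assumes "0 < r" "r < \<rho>" shows "long_gaps r D"
  unfolding long_gaps_def INFM_nat_le
proof
  fix m :: nat
  obtain j0 :: nat where j0: "3 / (\<rho> - r) \<le> real j0" using real_arch_simple by blast
  define j where "j = max j0 m"
  \<comment> \<open>Windows exclude their left end, so the gap starts with block
    \<open>4 ^ j + 1\<close>.\<close>
  define n where "n = (4 ^ j + 1) * l"
  have j: "j < 4 ^ j" by (rule power_gt_expt) simp
  have "4 ^ j * 1 \<le> n" unfolding n_def using l_pos by (intro mult_le_mono) auto
  then have "m \<le> n" using j unfolding j_def by linarith
  have "real j < real (4 ^ j)" using j by (simp only: of_nat_less_iff)
  moreover have "real j0 \<le> real j" by (simp add: j_def)
  moreover have "real (4 ^ j) = 4 ^ j" by simp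
  ultimately have "3 / (\<rho> - r) \<le> 4 ^ j" using j0 by linarith
  \<comment> \<open>Slack for the shifted start, \<open>1 + r < 2\<close> blocks, and for the block
    after that of \<open>i\<close>, which \<open>i + q\<close> may reach.\<close>
  then have big: "3 \<le> (\<rho> - r) * 4 ^ j" using assms by (simp add: divide_le_eq mult.commute)
  have "i \<notin> D" if i: "n \<le> i" "real i \<le> (1 + r) * real n" for i
  proof -
    have lower: "4 ^ j < i div l"
      using i(1) l_pos by (simp add: n_def less_eq_div_iff_mult_less_eq less_eq_Suc_le[of _ "i div l"])
    have "real i / real l \<le> (1 + r) * real n / real l" using i(2) by (intro divide_right_mono) auto
    also have "real n = (4 ^ j + 1) * real l" by (simp add: n_def algebra_simps)
    also have "(1 + r) * ((4 ^ j + 1) * real l) / real l = (1 + r) * (4 ^ j + 1)" using l_pos by simp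
    finally have "real i / real l \<le> (1 + r) * (4 ^ j + 1)" .
    moreover have "real (i div l) \<le> real i / real l" by (rule of_nat_div_le_of_nat)
    ultimately have "real (i div l) + 1 \<le> (1 + r) * (4 ^ j + 1) + 1" by linarith
    also have "\<dots> \<le> (1 + \<rho>) * 4 ^ j" using big assms \<rho> by (simp add: algebra_simps)
    finally have upper: "real (i div l) + 1 \<le> (1 + \<rho>) * 4 ^ j" .
    have "i div l \<le> (i + q) div l" by (intro div_le_mono) simp
    moreover have "(i + q) div l \<le> (i + l) div l" using q by (intro div_le_mono) simp
    then have "(i + q) div l \<le> i div l + 1" using l_pos by simp
    then have "real ((i + q) div l) \<le> real (i div l) + 1" by linarith
    ultimately have "(i + q) div l \<in> windows \<rho>" "i div l \<in> windows \<rho>"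
      unfolding windows_def using lower upper by (auto intro!: exI[of _ j])
    then show "i \<notin> D" by (intro inside)
  qed
  then show "\<exists>n\<ge>m. \<forall>i. n \<le> i \<and> real i \<le> (1 + r) * real n \<longrightarrow> i \<notin> D" using \<open>m \<le> n\<close> by blast
qed

text \<open>The next free block after \<open>n\<close> has a defect and starts within the factor
  \<open>1 + \<rho>\<close>, up to a bounded number of blocks that \<open>r - \<rho>\<close>
  absorbs.\<close>

lemma not_long_gaps_of_greater:
  assumes "\<rho> < r" shows "\<not> long_gaps r D"
proof
  assume "long_gaps r D"
  \<comment> \<open>\<open>4 * l\<close> bounds the rounding error \<open>(3 + \<rho>) * l\<close>
    accumulated below.\<close>
  obtain m :: nat where m: "4 * real l / (r - \<rho>) \<le> real m" using real_arch_simple by blast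
  obtain n where n: "n \<ge> m" "\<forall>i. n \<le> i \<and> real i \<le> (1 + r) * real n \<longrightarrow> i \<notin> D"
    using \<open>long_gaps r D\<close> unfolding long_gaps_def INFM_nat_le by blast
  have "4 * real l / (r - \<rho>) \<le> real n" using m n(1) by linarith
  then have big: "4 * real l \<le> (r - \<rho>) * real n" using assms by (simp add: divide_le_eq mult.commute)
  obtain i where i: "i \<ge> n div l + 1" "real i \<le> (1 + \<rho>) * real (n div l + 1) + 1" "i \<notin> windows \<rho>"
    using exists_not_in_windows[OF \<rho>, of "n div l + 1"] by blast
  have "n < (n div l + 1) * l" using dividend_less_div_times[OF l_pos, of n] by (simp add: algebra_simps)
  also have "\<dots> \<le> i * l" using i(1) by (rule mult_le_mono1)
  finally have "n \<le> i * l + p" by simp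
  moreover have "real (i * l + p) \<le> (1 + r) * real n"
  proof -
    have "n div l * l \<le> n" by simp
    then have "real (n div l * l) \<le> real n" by (simp only: of_nat_le_iff)
    then have nl: "real (n div l + 1) * real l \<le> real n + real l" by (simp add: algebra_simps)
    have "real (i * l + p) \<le> real i * real l + real l" using p by simp
    also have "real i * real l \<le> ((1 + \<rho>) * real (n div l + 1) + 1) * real l"
      using i(2) by (rule mult_right_mono) simp
    also have "\<dots> = (1 + \<rho>) * (real (n div l + 1) * real l) + real l" by (simp add: algebra_simps)
    also have "(1 + \<rho>) * (real (n div l + 1) * real l) \<le> (1 + \<rho>) * (real n + real l)"
      using nl \<rho> by (intro mult_left_mono) auto
    finally have "real (i * l + p) \<le> (1 + \<rho>) * real n + (3 + \<rho>) * real l" by (simp add: algebra_simps)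
    moreover have "(3 + \<rho>) * real l \<le> 4 * real l" using \<rho> by (intro mult_right_mono) auto
    ultimately show ?thesis using big by (simp add: algebra_simps)
  qed
  ultimately have "i * l + p \<notin> D" using n(2) by blast
  then show False using outside[OF i(3)] by simp
qed

lemma gap_ratio: "gap_ratio \<rho> D"
  unfolding gap_ratio_def using long_gaps_of_less not_long_gaps_of_greater by blast

end

subsection \<open>Sets of irregular points with prescribed gap ratio\<close>

definition defects :: "nat \<Rightarrow> (nat \<Rightarrow> nat) \<Rightarrow> nat set" where
  "defects q x = {i. x (i + q) \<noteq> x i}"

lemma defects_shift: "defects q (shift x) = {i. Suc i \<in> defects q x}"
  by (simp add: defects_def shift_def)

lemma sum_defects:
  "(\<Sum>j<n. (if (shift ^^ j) x q \<noteq> (shift ^^ j) x 0 then 1 else 0 :: real)) =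
     real (card (defects q x \<inter> {..<n}))"
proof -
  have "(\<Sum>j<n. (if (shift ^^ j) x q \<noteq> (shift ^^ j) x 0 then 1 else 0 :: real)) =
      (\<Sum>j<n. if j \<in> defects q x then 1 else 0)"
    by (intro sum.cong refl) (simp add: funpow_shift defects_def)
  also have "\<dots> = (\<Sum>j\<in>{..<n} \<inter> defects q x. 1)"
    by (rule sum.inter_restrict[symmetric]) simp
  finally show ?thesis by (simp add: Int_commute)
qed

context mixing_sft
begin

text \<open>The ratios \<open>t / 2 ^ Suc n\<close> lie below 1 for \<open>t < 2\<close> and become
  arbitrarily small, so the windows may be made as sparse as full dimension demands.\<close>

definition gap_set :: "real \<Rightarrow> (nat \<Rightarrow> nat) set" where
  "gap_set t = {x \<in> sft A. pos_upper_density (defects (2 * k) x) \<and>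
     (\<exists>n. gap_ratio (t / 2 ^ Suc n) (defects (2 * k) x))}"

lemma gap_set_subset: "gap_set t \<subseteq> sft A"
  by (auto simp: gap_set_def)

lemma shift_in_gap_set_iff:
  assumes "0 < t" "x \<in> sft A" shows "shift x \<in> gap_set t \<longleftrightarrow> x \<in> gap_set t"
proof -
  have "gap_ratio (t / 2 ^ Suc n) {i. Suc i \<in> defects (2 * k) x} \<longleftrightarrow>
      gap_ratio (t / 2 ^ Suc n) (defects (2 * k) x)" for n
    using assms by (intro gap_ratio_Suc_iff) simp
  then show ?thesis
    using assms shift_in_sft[of x A]
    by (simp add: gap_set_def defects_shift pos_upper_density_Suc_iff)
qed

text \<open>Membership can be carried backwards as well as forwards, which makes it independent of
  finite prefixes.\<close>

lemma funpow_shift_in_gap_set_iff: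
  assumes "0 < t" "x \<in> sft A" shows "(shift ^^ n) x \<in> gap_set t \<longleftrightarrow> x \<in> gap_set t"
proof (induction n)
  case (Suc n)
  then show ?case using shift_in_gap_set_iff[OF assms(1) funpow_shift_closed[OF assms(2)]] by simp
qed simp

lemma closure_of_gap_set:
  assumes "0 < t" "gap_set t \<noteq> {}" shows "mtopology closure_of gap_set t = sft A"
proof (rule closure_of_eq_spaceI)
  fix x n assume x: "x \<in> sft A"
  obtain y where y: "y \<in> gap_set t" using assms(2) by blast
  then have "y \<in> sft A" using gap_set_subset by blast
  then obtain z where z: "z \<in> sft A" "z \<in> cylinder n x" "(shift ^^ (n + k)) z = y"
    using exists_connecting_point[OF x] by blast
  then have "z \<in> gap_set t" using funpow_shift_in_gap_set_iff[OF assms(1) z(1), of "n + k"] y by simp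
  then show "\<exists>y\<in>gap_set t. y \<in> sft A \<inter> cylinder n x" using z by blast
qed

text \<open>A common ratio would make \<open>t / t'\<close> a power of 2, but quotients of numbers
  in (1, 2) lie strictly between 1/2 and 2, so the power is 1.\<close>

lemma gap_set_disjoint:
  assumes t: "t \<in> {1<..<2}" "t' \<in> {1<..<2}" "t \<noteq> t'"
  shows "gap_set t \<inter> gap_set t' = {}"
proof (rule ccontr)
  assume "gap_set t \<inter> gap_set t' \<noteq> {}"
  then obtain x m n where "gap_ratio (t / 2 ^ Suc m) (defects (2 * k) x)"
      "gap_ratio (t' / 2 ^ Suc n) (defects (2 * k) x)"
    unfolding gap_set_def by blast
  then have eq: "t / 2 ^ Suc m = t' / 2 ^ Suc n"
    using t by (intro gap_ratio_unique) auto
  have False if "m < n" "t / 2 ^ Suc m = t' / 2 ^ Suc n" "1 < t" "t' < 2" for m n and t t' :: real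
  proof -
    have "(2::real) ^ n = 2 ^ m * 2 ^ (n - m)" using that(1) by (simp add: power_add[symmetric])
    then have "t * 2 ^ (n - m) = t'" using that(2) by (simp add: field_simps)
    moreover have "(2::real) ^ 1 \<le> 2 ^ (n - m)" using that(1) by (intro power_increasing) auto
    then have "1 * 2 < t * 2 ^ (n - m)" using that(3) by (intro mult_less_le_imp_less) auto
    ultimately show False using that(4) by simp
  qed
  from this[OF _ eq] this[OF _ eq[symmetric]] t have "\<not> m < n" "\<not> n < m" by auto
  then have "m = n" by simp
  then show False using eq t(3) by simp
qed

lemma gap_set_irregular:
  assumes "0 < t"
  shows "gap_set t \<subseteq> irregular_set (sft A) (\<lambda>x. if x (2 * k) \<noteq> x 0 then 1 else 0)"
proof
  fix x assume x: "x \<in> gap_set t"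
  then obtain n where n: "gap_ratio (t / 2 ^ Suc n) (defects (2 * k) x)"
    unfolding gap_set_def by blast
  have "0 < t / 2 ^ Suc n" using assms by simp
  from Rats_dense_in_real[OF this] obtain r where r: "r \<in> \<rat>" "0 < r" "r < t / 2 ^ Suc n" by blast
  then have "long_gaps r (defects (2 * k) x)" using n unfolding gap_ratio_def by blast
  then have "\<not> convergent (\<lambda>n. real (card (defects (2 * k) x \<inter> {..<n})) / real n)"
    using x r(2) by (intro density_not_convergent) (auto simp: gap_set_def)
  then show "x \<in> irregular_set (sft A) (\<lambda>x. if x (2 * k) \<noteq> x 0 then 1 else 0)"
    using x gap_set_subset unfolding irregular_set_def sum_defects by blast
qed

text \<open>Unfolding leaves only quantifiers over naturals and rationals, applied to conditions on
  finitely many coordinates or independent of the point.\<close>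

lemma borel_gap_set: "gap_set t \<in> borel_subsets"
proof -
  interpret B: sigma_algebra "sft A" borel_subsets by (rule sigma_algebra_borel)
  let ?D = "defects (2 * k)"
  have mem: "{x \<in> sft A. i \<in> ?D x} \<in> borel_subsets" for i
    by (rule borel_finitely_determined[where n = "Suc (i + 2 * k)"]) (simp add: defects_def cylinder_def)
  have card: "{x \<in> sft A. n \<le> Suc m * card (?D x \<inter> {..<n})} \<in> borel_subsets" for m n
  proof (rule borel_finitely_determined[where n = "n + 2 * k"])
    fix x y assume y: "y \<in> cylinder (n + 2 * k) x" and le: "n \<le> Suc m * card (?D x \<inter> {..<n})"
    have "?D y \<inter> {..<n} = ?D x \<inter> {..<n}" using y by (auto simp: defects_def cylinder_def)
    then show "n \<le> Suc m * card (?D y \<inter> {..<n})" using le by simp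
  qed
  show ?thesis
    unfolding gap_set_def pos_upper_density_def gap_ratio_def long_gaps_def INFM_nat_le
    by (intro B.sets_Collect_conj B.sets_Collect_countable_Ex B.sets_Collect_countable_All
      B.sets_Collect_countable_All' B.sets_Collect_imp B.sets_Collect_neg B.sets_Collect_const countable_rat mem card)
qed

section \<open>Loops and points of the Moran construction\<close>

definition zero_loop :: "nat \<Rightarrow> nat" where
  "zero_loop = join k (connection 0 0) (connection 0 0)"

text \<open>\<open>zero_loop\<close> and \<open>one_loop\<close> are the loops \<open>u\<close> and
  \<open>v\<close>: they have the same length but pass through 0 and 1, respectively, at time
  \<open>k\<close>.\<close>

definition one_loop :: "nat \<Rightarrow> nat" where
  "one_loop = join k (connection 0 1) (connection 1 0)"

definition zero_point :: "nat \<Rightarrow> nat" where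
  "zero_point = concat_loops (2 * k) (\<lambda>_. zero_loop)"

text \<open>The opening \<open>u v\<close> puts 0 at position \<open>k\<close> and 1 at
  \<open>3 * k\<close>, hence a defect at \<open>k\<close>. The word of \<open>x\<close> starts at
  \<open>5 * k\<close>; connections lead to it from the state 0 and back.\<close>

definition word_loop :: "nat \<Rightarrow> (nat \<Rightarrow> nat) \<Rightarrow> nat \<Rightarrow> nat" where
  "word_loop n x = join (2 * k) zero_loop (join (2 * k) one_loop
     (join k (connection 0 (x 0)) (join n x (connection (x n) 0))))"

lemma path_zero_loop: "path (2 * k) 0 0 zero_loop"
  unfolding zero_loop_def mult_2 using two_states
  by (intro path_join[OF path_connection path_connection]) auto

lemma path_one_loop: "path (2 * k) 0 0 one_loop"
  unfolding one_loop_def mult_2 using two_states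
  by (intro path_join[OF path_connection path_connection]) auto

lemma zero_loop_k: "zero_loop k = 0"
  unfolding zero_loop_def join_def using path_connection[of 0 0] two_states by (simp add: path_def)

lemma one_loop_k: "one_loop k = 1"
  unfolding one_loop_def join_def using path_connection[of 1 0] two_states by (simp add: path_def)

lemma path_word_loop:
  assumes "x \<in> sft A"
  shows "path (2 * k + (2 * k + (k + (n + k)))) 0 0 (word_loop n x)"
  unfolding word_loop_def
  by (rule path_join[OF path_zero_loop path_join[OF path_one_loop
        path_join[OF path_connection path_join[OF path_of_sft[OF assms] path_connection]]]])
    (use two_states bounded[OF assms] in auto)

lemma word_loop_nth: "i < n \<Longrightarrow> word_loop n x (5 * k + i) = x i"
  unfolding word_loop_def join_def by auto

lemma word_loop_k: "word_loop n x k = 0" "word_loop n x (3 * k) = 1"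
  using k_pos zero_loop_k one_loop_k unfolding word_loop_def join_def by auto

lemma zero_point_periodic: "zero_point (i + 2 * k) = zero_point i"
  by (simp add: zero_point_def concat_loops_def)

text \<open>For block lengths divisible by the period, every window block is part of one global
  periodic sequence, so no defect arises where window blocks meet.\<close>

lemma zero_point_mod:
  assumes "2 * k dvd l" shows "zero_point (i mod l) = zero_point i"
  using assms by (simp add: zero_point_def concat_loops_def mod_mod_cancel)

lemma path_zero_point:
  assumes "2 * k dvd l" shows "path l 0 0 zero_point"
proof -
  have "zero_point \<in> sft A"
    unfolding zero_point_def using path_zero_loop k_pos by (intro concat_loops_in_sft[of _ 0]) auto
  then have "path l (zero_point 0) (zero_point l) zero_point" by (rule path_of_sft)
  moreover have "zero_point 0 = 0"
    using path_zero_loop by (simp add: zero_point_def concat_loops_def path_def)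
  moreover have "zero_point l = zero_point 0"
    using zero_point_mod[OF assms, of l] by simp
  ultimately show ?thesis by simp
qed

lemma Moran_point_in_gap_set:
  assumes t: "0 < t" "t < 2" and x: "\<And>i. x i \<in> sft A"
    and l: "l = 2 * k * (3 + j)" and \<rho>: "\<rho> = t / 2 ^ Suc n"
  shows "concat_loops l (\<lambda>i. if i \<in> windows \<rho> then zero_point else word_loop (2 * k * j) (x i)) \<in> gap_set t"
    (is "?y \<in> _")
proof -
  \<comment> \<open>Two loops, two connections and the word of length \<open>2 * k * j\<close>; the
    total is a multiple of \<open>2 * k\<close>, which keeps the periodic parts in phase.\<close>
  have len: "2 * k + (2 * k + (k + (2 * k * j + k))) = l" by (simp add: l algebra_simps)
  have dvd: "2 * k dvd l" by (simp add: l)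
  have l6: "6 * k \<le> l" by (simp add: l algebra_simps)
  then have l_pos: "0 < l" using k_pos by linarith
  have y_in: "?y \<in> sft A"
  proof (rule concat_loops_in_sft[of _ 0])
    show "path l 0 0 (if i \<in> windows \<rho> then zero_point else word_loop (2 * k * j) (x i))" for i
      using path_zero_point[OF dvd] path_word_loop[OF x[of i], of "2 * k * j"] unfolding len by simp
  qed (rule l_pos)
  interpret W: window_gaps \<rho> l k "2 * k" "defects (2 * k) ?y"
  proof
    show "0 < \<rho>" using t by (simp add: \<rho>)
    have "1 \<le> (2::real) ^ n" by (rule one_le_power) simp
    then have "t < 2 ^ Suc n" using t(2) unfolding power_Suc by linarith
    then show "\<rho> < 1" by (simp add: \<rho> divide_less_eq)
    show "k < l" "2 * k \<le> l" using l6 k_pos by linarith+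
    fix i
    show "i * l + k \<in> defects (2 * k) ?y" if "i \<notin> windows \<rho>"
    proof -
      have y: "?y (i * l + k) = 0" "?y (i * l + 3 * k) = 1"
        using that l6 k_pos concat_loops_block[of k l _ i] concat_loops_block[of "3 * k" l _ i]
        by (simp_all add: word_loop_k)
      have eq: "i * l + k + 2 * k = i * l + 3 * k" by simp
      show ?thesis unfolding defects_def mem_Collect_eq eq y by simp
    qed
    have zero: "?y i = zero_point i" if "i div l \<in> windows \<rho>" for i
      using that zero_point_mod[OF dvd, of i] by (simp add: concat_loops_def)
    show "i \<notin> defects (2 * k) ?y" if "i div l \<in> windows \<rho>" "(i + 2 * k) div l \<in> windows \<rho>"
      using zero[OF that(1)] zero[OF that(2)] by (simp add: defects_def zero_point_periodic)
  qed
  show ?thesis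
    unfolding gap_set_def using y_in W.pos_upper_density W.gap_ratio unfolding \<rho> by blast
qed

text \<open>The overhead \<open>6 * k\<close> of a loop is negligible for long words, so the rate
  per symbol of the loop still exceeds \<open>s\<close>.\<close>

lemma exists_word_length:
  assumes "s < growth"
  shows "\<exists>j. s * real (2 * k * (3 + j)) < ln (real (word_count (2 * k * j)))"
proof (cases "s < 0")
  case True
  have "s * real (2 * k * (3 + 0)) < 0" using True k_pos by (intro mult_neg_pos) auto
  moreover have "0 \<le> ln (real (word_count (2 * k * 0)))" using word_count_pos[of 0] by simp
  ultimately show ?thesis by (intro exI[of _ 0]) linarith
next
  case False
  obtain s' where s': "s < s'" "s' < growth" using dense[OF assms] by blast
  \<comment> \<open>For such \<open>n\<close> the difference \<open>s' - s\<close> absorbs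
    \<open>8 * k\<close> extra symbols: \<open>6 * k\<close> of overhead and \<open>2 * k\<close>
    from rounding up to a multiple of \<open>2 * k\<close>.\<close>
  obtain m :: nat where m: "8 * real k * s / (s' - s) \<le> real m" using real_arch_simple by blast
  have "\<not> (\<forall>\<^sub>F n in sequentially. \<not> exp (s' * real n) < real (word_count n))"
    using word_count_ge_exp[OF s'(2)] by (simp add: frequently_def)
  then obtain n where n: "n \<ge> m" "exp (s' * real n) < real (word_count n)"
    unfolding eventually_sequentially by blast
  define j where "j = n div (2 * k) + 1"
  have k2: "0 < 2 * k" using k_pos by simp
  have "n < 2 * k * j" using dividend_less_div_times[OF k2, of n] by (simp add: j_def algebra_simps)
  then have "word_count n \<le> word_count (2 * k * j)" by (intro word_count_mono) simp
  then have "exp (s' * real n) < real (word_count (2 * k * j))" using n(2) by linarith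
  then have "ln (exp (s' * real n)) < ln (real (word_count (2 * k * j)))"
    by (subst ln_less_cancel_iff) (auto simp: word_count_pos)
  then have ln: "s' * real n < ln (real (word_count (2 * k * j)))" by simp
  have "n div (2 * k) * (2 * k) \<le> n" by (rule div_times_less_eq_dividend)
  then have "2 * k * (3 + j) \<le> n + 8 * k" by (simp add: j_def algebra_simps)
  then have "real (2 * k * (3 + j)) \<le> real (n + 8 * k)" by (simp only: of_nat_le_iff)
  then have "s * real (2 * k * (3 + j)) \<le> s * real (n + 8 * k)"
    using False by (intro mult_left_mono) auto
  also have "\<dots> \<le> s' * real n"
  proof -
    have "8 * real k * s / (s' - s) \<le> real n" using m n(1) by linarith
    then have "8 * real k * s \<le> real n * (s' - s)" using s'(1) by (simp add: divide_le_eq)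
    then show ?thesis by (simp add: algebra_simps)
  qed
  finally show ?thesis using ln by (intro exI[of _ j]) linarith
qed

lemma cylinder_mass_gap_set:
  assumes t: "0 < t" "t < 2" and s: "s < growth"
  shows "cylinder_mass (gap_set t) s"
proof -
  obtain j where j: "s * real (2 * k * (3 + j)) < ln (real (word_count (2 * k * j)))"
    using exists_word_length[OF s] by blast
  define l where "l = 2 * k * (3 + j)"
  define a where "a = ln (real (word_count (2 * k * j)))"
  have a: "0 \<le> a" unfolding a_def using word_count_pos[of "2 * k * j"] by simp
  have sa: "0 < a - s * real l" using j by (simp add: a_def l_def)
  \<comment> \<open>Chosen so that \<rho> < \<epsilon> yields
    \<open>s * l \<le> (1 - 2 * \<rho>) * a\<close>; the summand 1 keeps the denominator positive
    when \<open>a = 0\<close>.\<close>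
  define \<epsilon> where "\<epsilon> = (a - s * real l) / (2 * a + 1)"
  have "0 < \<epsilon>" using sa a by (simp add: \<epsilon>_def)
  then obtain n where n: "(1 / 2 :: real) ^ n < \<epsilon>" using real_arch_pow_inv[of \<epsilon> "1/2"] by auto
  define \<rho> where "\<rho> = t / 2 ^ Suc n"
  have \<rho>_pos: "0 < \<rho>" using t by (simp add: \<rho>_def)
  have "\<rho> \<le> (1 / 2) ^ n" using t by (simp add: \<rho>_def power_one_over field_simps)
  then have "\<rho> * (2 * a + 1) \<le> \<epsilon> * (2 * a + 1)" using n a by (intro mult_right_mono) auto
  also have "\<dots> = a - s * real l" using a by (simp add: \<epsilon>_def)
  finally have le: "s * real l \<le> (1 - 2 * \<rho>) * a" using \<rho>_pos by (simp add: algebra_simps)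
  obtain r where r: "\<forall>x\<in>sft A. r (word (2 * k * j) x) \<in> sft A \<and>
      r (word (2 * k * j) x) \<in> cylinder (2 * k * j) x"
    using exists_word_inverse[of "2 * k * j"] by blast
  let ?W = "word (2 * k * j) ` sft A"
  have r_in: "r w \<in> sft A" if "w \<in> ?W" for w using that r by auto
  have word_r: "word (2 * k * j) (r w) = w" if "w \<in> ?W" for w using that r by (auto simp: word_eq_iff)
  show ?thesis
  proof (rule Moran_cylinder_mass[where W = ?W and l = l and \<theta> = "1 - 2 * \<rho>" and V = "windows \<rho>"
        and g = "\<lambda>w. word_loop (2 * k * j) (r w)" and z = zero_point])
    show "finite ?W" by (rule finite_words)
    show "?W \<noteq> {}" using nonempty by simp
    show "0 < l" using k_pos by (simp add: l_def)
    show "s * real l \<le> (1 - 2 * \<rho>) * ln (real (card ?W))"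
      using le by (simp add: a_def word_count_def)
    show "(1 - 2 * \<rho>) * real b \<le> real (card ({..<b} - windows \<rho>))" for b
      using \<rho>_pos by (rule card_diff_windows_ge)
    show "concat_loops l (\<lambda>i. if i \<in> windows \<rho> then zero_point else word_loop (2 * k * j) (r (\<omega> i))) \<in> gap_set t"
      if "\<And>i. \<omega> i \<in> ?W" for \<omega>
      using that r_in by (intro Moran_point_in_gap_set[OF t _ l_def \<rho>_def]) blast
    fix w w' assume w: "w \<in> ?W" "w' \<in> ?W"
      and eq: "\<forall>i<l. word_loop (2 * k * j) (r w) i = word_loop (2 * k * j) (r w') i"
    have "r w i = r w' i" if "i < 2 * k * j" for i
    proof -
      have "5 * k + i < l" using that k_pos by (simp add: l_def algebra_simps)
      then show ?thesis using eq word_loop_nth[OF that] by metis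
    qed
    then have "word (2 * k * j) (r w) = word (2 * k * j) (r w')" by (simp add: word_def)
    then show "w = w'" by (simp only: word_r w)
  qed
qed

text \<open>The empty set is covered by no cylinders at all, at cost 0, so a set with cylinder mass
  is nonempty.\<close>

lemma gap_set_nonempty:
  assumes "0 < t" "t < 2" shows "gap_set t \<noteq> {}"
proof
  assume "gap_set t = {}"
  then have "cylinder_mass {} (growth - 1)"
    using cylinder_mass_gap_set[OF assms, of "growth - 1"] by simp
  then obtain c where c: "0 < c" "\<And>(J::nat set) w n. {} \<subseteq> (\<Union>i\<in>J. cylinder (n i) (w i)) \<Longrightarrow>
     ennreal c \<le> (\<Sum>\<^sub>\<infinity>i\<in>J. ennreal (exp (- (growth - 1) * real (n i))))"
    unfolding cylinder_mass_def by blast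
  have "ennreal c \<le> 0" using c(2)[of "\<lambda>_. 0" undefined "{}"] by simp
  then show False using c(1) by simp
qed

end

theorem theorem1p1:
  fixes A :: "nat mat" and d :: nat
    and X :: "(nat \<Rightarrow> nat) set" and T :: "(nat \<Rightarrow> nat) topology"
  defines "X \<equiv> sft A"
    and "T \<equiv> Metric_space.mtopology X seq_dist"
  assumes "A \<in> carrier_mat d d"
    and "elements_mat A \<subseteq> {0, 1}"
    and "d \<ge> 2"
    and "aperiodic A"
  shows "\<exists>\<N> :: (nat \<Rightarrow> nat) set set.
    uncountable \<N> \<and>
    (\<forall>N\<in>\<N>. N \<in> Metric_space.borel_subsets X seq_dist) \<and>
    (\<exists>\<phi> :: (nat \<Rightarrow> nat) \<Rightarrow> real. continuous_map T euclideanreal \<phi> \<and>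
       (\<forall>N\<in>\<N>. N \<subseteq> irregular_set X \<phi>)) \<and>
    (\<forall>N\<in>\<N>. T closure_of N = X \<and> shift ` N \<subseteq> N) \<and>
    (\<forall>N\<in>\<N>. \<forall>N'\<in>\<N>. N \<noteq> N' \<longrightarrow> N \<inter> N' = {}) \<and>
    (\<forall>N\<in>\<N>.
       Metric_space.hausdorff_dim X seq_dist N = Metric_space.hausdorff_dim X seq_dist X \<and>
       Metric_space.entropy_on X seq_dist shift N
         = Metric_space.topological_entropy X seq_dist shift)"
proof -
  obtain k where k: "k \<ge> 1" "\<And>i j. i < d \<Longrightarrow> j < d \<Longrightarrow> (A ^\<^sub>m k) $$ (i, j) > 0"
    using assms(3,6) unfolding aperiodic_def by auto
  interpret mixing_sft A d k
    using assms(3-5) k by unfold_locales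
  let ?\<N> = "gap_set ` {1<..<2}"
  define \<phi> :: "(nat \<Rightarrow> nat) \<Rightarrow> real" where "\<phi> x = (if x (2 * k) \<noteq> x 0 then 1 else 0)" for x
  \<comment> \<open>Disjoint nonempty sets are distinct, so the family inherits uncountability from
    the interval.\<close>
  have "inj_on gap_set {1<..<2}"
  proof (rule inj_onI, rule ccontr)
    fix t t' :: real assume t: "t \<in> {1<..<2}" "t' \<in> {1<..<2}" "gap_set t = gap_set t'" "t \<noteq> t'"
    have "gap_set t \<noteq> {}" using t(1) by (intro gap_set_nonempty) auto
    then show False using gap_set_disjoint[OF t(1,2,4)] t(3) by simp
  qed
  then have unc: "uncountable ?\<N>"
    using uncountable_open_interval[of 1 "2::real"] countable_image_inj_on[of gap_set "{1<..<2}"]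
    by auto
  have cont: "continuous_map mtopology euclideanreal \<phi>"
    by (rule continuous_map_finitely_determined[of "Suc (2 * k)"]) (simp add: \<phi>_def cylinder_def)
  have irr: "gap_set t \<subseteq> irregular_set (sft A) \<phi>" if "t \<in> {1<..<2}" for t
    using gap_set_irregular[of t] that unfolding \<phi>_def[abs_def] by simp
  have dense: "mtopology closure_of gap_set t = sft A" if "t \<in> {1<..<2}" for t
    using that gap_set_nonempty[of t] by (intro closure_of_gap_set) auto
  have inv: "shift ` gap_set t \<subseteq> gap_set t" if "t \<in> {1<..<2}" for t
    using that shift_in_gap_set_iff[of t] gap_set_subset[of t] by auto
  have mass: "cylinder_mass (gap_set t) s" if "t \<in> {1<..<2}" "s < growth" for t s
    using that by (intro cylinder_mass_gap_set) auto
  have dim: "hausdorff_dim (gap_set t) = hausdorff_dim (sft A)" if "t \<in> {1<..<2}" for t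
  proof -
    \<comment> \<open>The lower bound for the whole space comes from its subset
      \<open>gap_set t\<close>.\<close>
    have "cylinder_mass (sft A) s" if "s < growth" for s
      using cylinder_mass_mono[OF mass[OF \<open>t \<in> {1<..<2}\<close> that] order_refl gap_set_subset] .
    then show ?thesis
      using hausdorff_dim_eq_growth[OF gap_set_subset mass[OF that]]
        hausdorff_dim_eq_growth[OF order_refl] by simp
  qed
  have ent: "entropy_on shift (gap_set t) = topological_entropy shift" if "t \<in> {1<..<2}" for t
    using entropy_on_eq_growth[OF gap_set_subset mass[OF that]] topological_entropy_eq_growth by simp
  show ?thesis
    unfolding X_def T_def
  proof (intro exI[of _ ?\<N>] conjI exI[of _ \<phi>])
    show "uncountable ?\<N>" by (rule unc)
    show "continuous_map mtopology euclideanreal \<phi>" by (rule cont)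
    show "\<forall>N\<in>?\<N>. \<forall>N'\<in>?\<N>. N \<noteq> N' \<longrightarrow> N \<inter> N' = {}"
    proof (intro ballI impI, elim imageE)
      fix N N' t t' assume N: "N \<noteq> N'" "N = gap_set t" "t \<in> {1<..<2}" "N' = gap_set t'" "t' \<in> {1<..<2}"
      then have "t \<noteq> t'" by blast
      from gap_set_disjoint[OF N(3,5) this] N(2,4) show "N \<inter> N' = {}" by simp
    qed
    show "\<forall>N\<in>?\<N>. N \<in> borel_subsets" by (intro ballI) (elim imageE, simp only: borel_gap_set)
    show "\<forall>N\<in>?\<N>. N \<subseteq> irregular_set (sft A) \<phi>" by (intro ballI) (elim imageE, simp only: irr)
    show "\<forall>N\<in>?\<N>. mtopology closure_of N = sft A \<and> shift ` N \<subseteq> N"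
      by (intro ballI) (elim imageE, simp only: dense inv simp_thms)
    show "\<forall>N\<in>?\<N>. hausdorff_dim N = hausdorff_dim (sft A) \<and> entropy_on shift N = topological_entropy shift"
      by (intro ballI) (elim imageE, simp only: dim ent simp_thms)
  qed
qed

end
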